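(* Let $\mathcal{M}_{\mathcal{D}}$ be the class of all individuals of the realizability model $\mathcal{N}$, equipped with the relations $x\in_{\mathcal{D}}y\equiv\mathcal{D}[\langle x\in y\rangle]$ and $x=_{\mathcal{D}}y\equiv\mathcal{D}[\langle x=y\rangle]$. Then $\mathcal{M}_{\mathcal{D}}$ is an elementary extension of the ground model $\mathcal{M}$: for every closed formula $F[a_1,\dots,a_n]$ of ZF with parameters $a_1,\dots,a_n$ in $\mathcal{M}$, if $\mathcal{M}\models F[\vec a]$ then $\Vdash(\mathcal{M}_{\mathcal{D}}\models F[\vec a])$, and if $\mathcal{M}\not\models F[\vec a]$ then $\Vdash(\mathcal{M}_{\mathcal{D}}\models\neg F[\vec a])$.
   Context: Classical realizability (Krivine): ground model $\mathcal{M}$ of ZF + V = L with a realizability algebra $(\Lambda,\Pi,\Lambda\star\Pi,\mathrm{QP},\perp\!\!\!\perp)$; $\mathcal{N}$ has the same individuals as $\mathcal{M}$; formulas of ZF$_\varepsilon$ (atomic $a\not\varepsilon b$, $a\notin b$, $a\subset b$, $\bot$; $\to,\forall$; function symbols defined in $\mathcal{M}$) get truth values $\|F\|\subseteq\Pi$ with $\|a\not\varepsilon b\|=\{\pi:(a,\pi)\in b\}$, $\|F\to G\|=\{\xi\cdot\pi:\xi\Vdash F,\pi\in\|G\|\}$, $\|\forall xF\|=\bigcup_a\|F[a]\|$; $\xi\Vdash F$ iff $\xi\star\pi\in\perp\!\!\!\perp$ for all $\pi\in\|F\|$; "$\Vdash F$" means realized by a proof-like term. $\beth2=\{0,1\}\times\Pi$,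 Boolean algebra in $\mathcal{N}$. For a ZF formula $F[\vec x]$, $\langle F[\vec x]\rangle\in\{0,1\}$ is the function symbol defined in $\mathcal{M}$ by $\langle F[\vec a]\rangle=1$ iff $\mathcal{M}\models F[\vec a]$; in $\mathcal{N}$ it takes values in $\beth2$. $\langle y<x\rangle$ is the characteristic function of $y\in\mathrm{Cl}(x)$; $\mathcal{D}[\alpha]\equiv\forall X(\forall x(\forall y(\langle y<x\rangle\ge\alpha\hookrightarrow y\not\varepsilon X)\to x\not\varepsilon X)\to\forall x(x\not\varepsilon X))$, where $\|R\hookrightarrow F\|=\|F\|$ if $R$ holds in $\mathcal{M}$ and $\emptyset$ otherwise. The ZF$_\varepsilon$ formula $(\mathcal{M}_{\mathcal{D}}\models F)$ is defined by recursion: atomic $x_1\in x_2$ becomes $x_1\in_{\mathcal{D}}x_2$, $x_1=x_2$ becomes $x_1=_{\mathcal{D}}x_2$, $\bot$ becomes $\bot$; it commutes with $\to$ and $\forall$. *)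

theory Defs
  imports Main
begin

section \<open>Formulas of set theory and their satisfaction\<close>

text \<open>
  A structure for the language of ZF is a type \<open>'v\<close> of individuals with a binary relation
  \<open>E\<close>, where \<open>E x y\<close> means that x is an element of y.  The structure may be ill-founded, so
  every set-theoretic notion below is relative to \<open>E\<close> and quantifies over \<open>'v\<close>.
  Variables are de Bruijn indices; a closed formula with parameters is a formula together with
  an assignment of individuals to its free variables.
\<close>

datatype fm =
    Mem nat nat
  | Eq nat nat
  | Fls
  | Impl fm fm
  | Forall fm

definition Neg :: "fm \<Rightarrow> fm" where
  "Neg F = Impl F Fls"

primrec sat :: "('v \<Rightarrow> 'v \<Rightarrow> bool) \<Rightarrow> fm \<Rightarrow> (nat \<Rightarrow> 'v) \<Rightarrow> bool" where
  "sat E (Mem i j) e \<longleftrightarrow> E (e i) (e j)"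
| "sat E (Eq i j) e \<longleftrightarrow> e i = e j"
| "sat E Fls e \<longleftrightarrow> False"
| "sat E (Impl F G) e \<longleftrightarrow> (sat E F e \<longrightarrow> sat E G e)"
| "sat E (Forall F) e \<longleftrightarrow> (\<forall>a. sat E F (case_nat a e))"


section \<open>Set-theoretic notions inside a structure\<close>

text \<open>\<open>mset E P\<close> is the individual whose elements are exactly those satisfying P; it is
  meaningful only when such an individual exists (it is then unique by extensionality).\<close>

definition mset :: "('v \<Rightarrow> 'v \<Rightarrow> bool) \<Rightarrow> ('v \<Rightarrow> bool) \<Rightarrow> 'v" where
  "mset E P = (THE a. \<forall>x. E x a \<longleftrightarrow> P x)"

definition empty :: "('v \<Rightarrow> 'v \<Rightarrow> bool) \<Rightarrow> 'v" where
  "empty E = mset E (\<lambda>x. False)"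

definition upair :: "('v \<Rightarrow> 'v \<Rightarrow> bool) \<Rightarrow> 'v \<Rightarrow> 'v \<Rightarrow> 'v" where
  "upair E a b = mset E (\<lambda>x. x = a \<or> x = b)"

definition pair :: "('v \<Rightarrow> 'v \<Rightarrow> bool) \<Rightarrow> 'v \<Rightarrow> 'v \<Rightarrow> 'v" where
  "pair E a b = upair E (upair E a a) (upair E a b)"

definition one :: "('v \<Rightarrow> 'v \<Rightarrow> bool) \<Rightarrow> 'v" where
  "one E = upair E (empty E) (empty E)"

definition subset :: "('v \<Rightarrow> 'v \<Rightarrow> bool) \<Rightarrow> 'v \<Rightarrow> 'v \<Rightarrow> bool" where
  "subset E a b \<longleftrightarrow> (\<forall>x. E x a \<longrightarrow> E x b)"

definition transitive :: "('v \<Rightarrow> 'v \<Rightarrow> bool) \<Rightarrow> 'v \<Rightarrow> bool" where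
  "transitive E a \<longleftrightarrow> (\<forall>x. E x a \<longrightarrow> subset E x a)"

text \<open>Membership of y in the transitive closure of x, the least transitive set including x
  (so \<open>below E\<close> is a strict relation).\<close>

definition below :: "('v \<Rightarrow> 'v \<Rightarrow> bool) \<Rightarrow> 'v \<Rightarrow> 'v \<Rightarrow> bool" where
  "below E y x \<longleftrightarrow> (\<forall>T. transitive E T \<longrightarrow> subset E x T \<longrightarrow> E y T)"

definition is_succ :: "('v \<Rightarrow> 'v \<Rightarrow> bool) \<Rightarrow> 'v \<Rightarrow> 'v \<Rightarrow> bool" where
  "is_succ E x s \<longleftrightarrow> (\<forall>z. E z s \<longleftrightarrow> E z x \<or> z = x)"

definition inductive_set_in :: "('v \<Rightarrow> 'v \<Rightarrow> bool) \<Rightarrow> 'v \<Rightarrow> bool" where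
  "inductive_set_in E w \<longleftrightarrow>
     (\<exists>z. E z w \<and> (\<forall>x. \<not> E x z)) \<and> (\<forall>x. E x w \<longrightarrow> (\<exists>s. E s w \<and> is_succ E x s))"

definition omega :: "('v \<Rightarrow> 'v \<Rightarrow> bool) \<Rightarrow> 'v" where
  "omega E = mset E (\<lambda>n. \<forall>w. inductive_set_in E w \<longrightarrow> E n w)"

definition ordinal :: "('v \<Rightarrow> 'v \<Rightarrow> bool) \<Rightarrow> 'v \<Rightarrow> bool" where
  "ordinal E a \<longleftrightarrow> transitive E a \<and> (\<forall>x. E x a \<longrightarrow> transitive E x)"

definition function_on :: "('v \<Rightarrow> 'v \<Rightarrow> bool) \<Rightarrow> 'v \<Rightarrow> 'v \<Rightarrow> bool" where
  "function_on E f d \<longleftrightarrow>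
     (\<forall>p. E p f \<longrightarrow> (\<exists>x y. E x d \<and> p = pair E x y)) \<and>
     (\<forall>x. E x d \<longrightarrow> (\<exists>!y. E (pair E x y) f))"

definition app :: "('v \<Rightarrow> 'v \<Rightarrow> bool) \<Rightarrow> 'v \<Rightarrow> 'v \<Rightarrow> 'v" where
  "app E f x = (THE y. E (pair E x y) f)"


section \<open>The axioms of ZF and V = L\<close>

definition zf_model :: "('v \<Rightarrow> 'v \<Rightarrow> bool) \<Rightarrow> bool" where
  "zf_model E \<longleftrightarrow>
     \<comment> \<open>extensionality\<close>
     (\<forall>a b. (\<forall>x. E x a \<longleftrightarrow> E x b) \<longrightarrow> a = b) \<and>
     \<comment> \<open>foundation\<close>
     (\<forall>a. (\<exists>x. E x a) \<longrightarrow> (\<exists>x. E x a \<and> (\<forall>y. E y x \<longrightarrow> \<not> E y a))) \<and>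
     \<comment> \<open>pairing\<close>
     (\<forall>a b. \<exists>c. \<forall>x. E x c \<longleftrightarrow> x = a \<or> x = b) \<and>
     \<comment> \<open>union\<close>
     (\<forall>a. \<exists>u. \<forall>x. E x u \<longleftrightarrow> (\<exists>y. E x y \<and> E y a)) \<and>
     \<comment> \<open>power set\<close>
     (\<forall>a. \<exists>p. \<forall>x. E x p \<longleftrightarrow> subset E x a) \<and>
     \<comment> \<open>infinity\<close>
     (\<exists>w. inductive_set_in E w) \<and>
     \<comment> \<open>separation schema\<close>
     (\<forall>F e a. \<exists>b. \<forall>x. E x b \<longleftrightarrow> E x a \<and> sat E F (case_nat x e)) \<and>
     \<comment> \<open>replacement schema\<close>
     (\<forall>F e a.
        (\<forall>x y y'. E x a \<longrightarrow> sat E F (case_nat y (case_nat x e)) \<longrightarrow>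
           sat E F (case_nat y' (case_nat x e)) \<longrightarrow> y = y') \<longrightarrow>
        (\<exists>b. \<forall>y. E y b \<longleftrightarrow> (\<exists>x. E x a \<and> sat E F (case_nat y (case_nat x e)))))"

text \<open>
  Definability over a set A must be internal to the structure, since its natural numbers may be
  nonstandard.  The relations on A definable without parameters are sets of internal
  assignments \<open>s : \<omega> \<rightarrow> A\<close>; they form the least family containing the membership and equality
  diagonals and closed under complement, intersection and projection along a coordinate.
\<close>

definition assignment :: "('v \<Rightarrow> 'v \<Rightarrow> bool) \<Rightarrow> 'v \<Rightarrow> 'v \<Rightarrow> bool" where
  "assignment E A s \<longleftrightarrow>
     function_on E s (omega E) \<and> (\<forall>n. E n (omega E) \<longrightarrow> E (app E s n) A)"

text \<open>The assignments s and t agree except possibly at the coordinate i.\<close>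

definition variant :: "('v \<Rightarrow> 'v \<Rightarrow> bool) \<Rightarrow> 'v \<Rightarrow> 'v \<Rightarrow> 'v \<Rightarrow> bool" where
  "variant E i s t \<longleftrightarrow> (\<forall>n. E n (omega E) \<longrightarrow> n \<noteq> i \<longrightarrow> app E t n = app E s n)"

definition closed_family :: "('v \<Rightarrow> 'v \<Rightarrow> bool) \<Rightarrow> 'v \<Rightarrow> 'v \<Rightarrow> bool" where
  "closed_family E A D \<longleftrightarrow>
     (\<forall>i j. E i (omega E) \<longrightarrow> E j (omega E) \<longrightarrow>
        E (mset E (\<lambda>s. assignment E A s \<and> E (app E s i) (app E s j))) D \<and>
        E (mset E (\<lambda>s. assignment E A s \<and> app E s i = app E s j)) D) \<and>
     (\<forall>R. E R D \<longrightarrow> E (mset E (\<lambda>s. assignment E A s \<and> \<not> E s R)) D) \<and>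
     (\<forall>R S. E R D \<longrightarrow> E S D \<longrightarrow> E (mset E (\<lambda>s. E s R \<and> E s S)) D) \<and>
     (\<forall>R i. E R D \<longrightarrow> E i (omega E) \<longrightarrow>
        E (mset E (\<lambda>s. assignment E A s \<and>
             (\<exists>t. assignment E A t \<and> variant E i s t \<and> E t R))) D)"

definition definable_relation :: "('v \<Rightarrow> 'v \<Rightarrow> bool) \<Rightarrow> 'v \<Rightarrow> 'v \<Rightarrow> bool" where
  "definable_relation E A R \<longleftrightarrow> (\<forall>D. closed_family E A D \<longrightarrow> E R D)"

text \<open>
  X is a subset of A definable over A with parameters: coordinate 0 is the defined variable and
  the other coordinates of s carry the parameters.  The disjunct for empty X is needed when A is
  empty, as there are then no assignments.
\<close>

definition definable_subset :: "('v \<Rightarrow> 'v \<Rightarrow> bool) \<Rightarrow> 'v \<Rightarrow> 'v \<Rightarrow> bool" where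
  "definable_subset E A X \<longleftrightarrow>
     (\<forall>x. \<not> E x X) \<or>
     (\<exists>R s. definable_relation E A R \<and> assignment E A s \<and>
        (\<forall>x. E x X \<longleftrightarrow> E x A \<and>
           (\<exists>t. assignment E A t \<and> variant E (empty E) s t \<and> app E t (empty E) = x \<and> E t R)))"

text \<open>The function f is the sequence of the levels \<open>L\<^sub>\<beta>\<close> for \<open>\<beta> < \<alpha>\<close>, where \<open>L\<^sub>\<beta>\<close> is the union
  of \<open>Def(L\<^sub>\<gamma>)\<close> over \<open>\<gamma> < \<beta>\<close>.  This one clause subsumes the zero, successor and limit cases,
  because the levels increase and \<open>L\<^sub>\<gamma> \<subseteq> Def(L\<^sub>\<gamma>)\<close>.\<close>

definition constructible_levels :: "('v \<Rightarrow> 'v \<Rightarrow> bool) \<Rightarrow> 'v \<Rightarrow> 'v \<Rightarrow> bool" where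
  "constructible_levels E \<alpha> f \<longleftrightarrow>
     ordinal E \<alpha> \<and> function_on E f \<alpha> \<and>
     (\<forall>\<beta>. E \<beta> \<alpha> \<longrightarrow>
        (\<forall>x. E x (app E f \<beta>) \<longleftrightarrow> (\<exists>\<gamma>. E \<gamma> \<beta> \<and> definable_subset E (app E f \<gamma>) x)))"

definition V_equals_L :: "('v \<Rightarrow> 'v \<Rightarrow> bool) \<Rightarrow> bool" where
  "V_equals_L E \<longleftrightarrow>
     (\<forall>x. \<exists>\<alpha> f \<beta>. constructible_levels E \<alpha> f \<and> E \<beta> \<alpha> \<and> E x (app E f \<beta>))"


section \<open>Realizability algebras in the ground model\<close>

text \<open>
  The sets of terms, stacks, processes, proof-like terms and the pole are individuals of the
  ground model.  The operations are given as functions on individuals; only their restrictions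
  to terms and stacks matter, and these are required to be sets of the ground model.
\<close>

record 'v ralg =
  Terms :: 'v
  Stacks :: 'v
  Procs :: 'v
  QP :: 'v
  Pole :: 'v
  ap :: "'v \<Rightarrow> 'v \<Rightarrow> 'v"
  push :: "'v \<Rightarrow> 'v \<Rightarrow> 'v"
  proc :: "'v \<Rightarrow> 'v \<Rightarrow> 'v"
  kont :: "'v \<Rightarrow> 'v"
  cB :: 'v
  cC :: 'v
  cE :: 'v
  cI :: 'v
  cK :: 'v
  cW :: 'v
  callcc :: 'v

definition internal_op1 :: "('v \<Rightarrow> 'v \<Rightarrow> bool) \<Rightarrow> 'v \<Rightarrow> 'v \<Rightarrow> ('v \<Rightarrow> 'v) \<Rightarrow> bool" where
  "internal_op1 E A B f \<longleftrightarrow>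
     (\<forall>x. E x A \<longrightarrow> E (f x) B) \<and>
     (\<exists>g. \<forall>p. E p g \<longleftrightarrow> (\<exists>x. E x A \<and> p = pair E x (f x)))"

definition internal_op2 ::
  "('v \<Rightarrow> 'v \<Rightarrow> bool) \<Rightarrow> 'v \<Rightarrow> 'v \<Rightarrow> 'v \<Rightarrow> ('v \<Rightarrow> 'v \<Rightarrow> 'v) \<Rightarrow> bool" where
  "internal_op2 E A B C f \<longleftrightarrow>
     (\<forall>x y. E x A \<longrightarrow> E y B \<longrightarrow> E (f x y) C) \<and>
     (\<exists>g. \<forall>p. E p g \<longleftrightarrow> (\<exists>x y. E x A \<and> E y B \<and> p = pair E (pair E x y) (f x y)))"

text \<open>One step of execution; the preorder on processes is its reflexive transitive closure.\<close>

inductive step :: "('v \<Rightarrow> 'v \<Rightarrow> bool) \<Rightarrow> 'v ralg \<Rightarrow> 'v \<Rightarrow> 'v \<Rightarrow> bool"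
  for E :: "'v \<Rightarrow> 'v \<Rightarrow> bool" and \<A> :: "'v ralg" where
  "E \<xi> (Terms \<A>) \<Longrightarrow> E \<eta> (Terms \<A>) \<Longrightarrow> E \<pi> (Stacks \<A>) \<Longrightarrow>
     step E \<A> (proc \<A> (ap \<A> \<xi> \<eta>) \<pi>) (proc \<A> \<xi> (push \<A> \<eta> \<pi>))"
| "E \<xi> (Terms \<A>) \<Longrightarrow> E \<pi> (Stacks \<A>) \<Longrightarrow>
     step E \<A> (proc \<A> (cI \<A>) (push \<A> \<xi> \<pi>)) (proc \<A> \<xi> \<pi>)"
| "E \<xi> (Terms \<A>) \<Longrightarrow> E \<eta> (Terms \<A>) \<Longrightarrow> E \<pi> (Stacks \<A>) \<Longrightarrow>
     step E \<A> (proc \<A> (cK \<A>) (push \<A> \<xi> (push \<A> \<eta> \<pi>))) (proc \<A> \<xi> \<pi>)"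
| "E \<xi> (Terms \<A>) \<Longrightarrow> E \<eta> (Terms \<A>) \<Longrightarrow> E \<pi> (Stacks \<A>) \<Longrightarrow>
     step E \<A> (proc \<A> (cE \<A>) (push \<A> \<xi> (push \<A> \<eta> \<pi>))) (proc \<A> (ap \<A> \<xi> \<eta>) \<pi>)"
| "E \<xi> (Terms \<A>) \<Longrightarrow> E \<eta> (Terms \<A>) \<Longrightarrow> E \<pi> (Stacks \<A>) \<Longrightarrow>
     step E \<A> (proc \<A> (cW \<A>) (push \<A> \<xi> (push \<A> \<eta> \<pi>)))
              (proc \<A> \<xi> (push \<A> \<eta> (push \<A> \<eta> \<pi>)))"
| "E \<xi> (Terms \<A>) \<Longrightarrow> E \<eta> (Terms \<A>) \<Longrightarrow> E \<zeta> (Terms \<A>) \<Longrightarrow> E \<pi> (Stacks \<A>) \<Longrightarrow>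
     step E \<A> (proc \<A> (cC \<A>) (push \<A> \<xi> (push \<A> \<eta> (push \<A> \<zeta> \<pi>))))
              (proc \<A> \<xi> (push \<A> \<zeta> (push \<A> \<eta> \<pi>)))"
| "E \<xi> (Terms \<A>) \<Longrightarrow> E \<eta> (Terms \<A>) \<Longrightarrow> E \<zeta> (Terms \<A>) \<Longrightarrow> E \<pi> (Stacks \<A>) \<Longrightarrow>
     step E \<A> (proc \<A> (cB \<A>) (push \<A> \<xi> (push \<A> \<eta> (push \<A> \<zeta> \<pi>))))
              (proc \<A> (ap \<A> \<xi> (ap \<A> \<eta> \<zeta>)) \<pi>)"
| "E \<xi> (Terms \<A>) \<Longrightarrow> E \<pi> (Stacks \<A>) \<Longrightarrow>
     step E \<A> (proc \<A> (callcc \<A>) (push \<A> \<xi> \<pi>)) (proc \<A> \<xi> (push \<A> (kont \<A> \<pi>) \<pi>))"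
| "E \<xi> (Terms \<A>) \<Longrightarrow> E \<pi> (Stacks \<A>) \<Longrightarrow> E \<rho> (Stacks \<A>) \<Longrightarrow>
     step E \<A> (proc \<A> (kont \<A> \<pi>) (push \<A> \<xi> \<rho>)) (proc \<A> \<xi> \<pi>)"

definition realizability_algebra :: "('v \<Rightarrow> 'v \<Rightarrow> bool) \<Rightarrow> 'v ralg \<Rightarrow> bool" where
  "realizability_algebra E \<A> \<longleftrightarrow>
     internal_op2 E (Terms \<A>) (Terms \<A>) (Terms \<A>) (ap \<A>) \<and>
     internal_op2 E (Terms \<A>) (Stacks \<A>) (Stacks \<A>) (push \<A>) \<and>
     internal_op2 E (Terms \<A>) (Stacks \<A>) (Procs \<A>) (proc \<A>) \<and>
     internal_op1 E (Stacks \<A>) (Terms \<A>) (kont \<A>) \<and>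
     subset E (QP \<A>) (Terms \<A>) \<and>
     (\<forall>c \<in> {cB \<A>, cC \<A>, cE \<A>, cI \<A>, cK \<A>, cW \<A>, callcc \<A>}. E c (QP \<A>)) \<and>
     (\<forall>\<xi> \<eta>. E \<xi> (QP \<A>) \<longrightarrow> E \<eta> (QP \<A>) \<longrightarrow> E (ap \<A> \<xi> \<eta>) (QP \<A>)) \<and>
     subset E (Pole \<A>) (Procs \<A>) \<and>
     (\<forall>p q. (step E \<A>)\<^sup>*\<^sup>* p q \<longrightarrow> E q (Pole \<A>) \<longrightarrow> E p (Pole \<A>))"


section \<open>Formulas of \<open>ZF\<^sub>\<epsilon>\<close> and their truth values\<close>

text \<open>
  A function symbol is represented by its interpretation on lists of individuals, and the
  relation R of a guarded formula \<open>R \<hookrightarrow> F\<close> by its truth set.  The only ones used below are first-order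
  definable in the ground model.
\<close>

datatype 'v trm =
    Var nat
  | Fn "'v list \<Rightarrow> 'v" "'v trm list"

datatype 'v efm =
    NotEps "'v trm" "'v trm"
  | NotIn "'v trm" "'v trm"
  | Incl "'v trm" "'v trm"
  | EFls
  | EImpl "'v efm" "'v efm"
  | EForall "'v efm"
  | Guard "'v list \<Rightarrow> bool" "'v trm list" "'v efm"

primrec eval :: "(nat \<Rightarrow> 'v) \<Rightarrow> 'v trm \<Rightarrow> 'v" where
  "eval e (Var n) = e n"
| "eval e (Fn f ts) = f (map (eval e) ts)"

text \<open>Renaming of a term moved under k additional quantifiers.\<close>

primrec lift :: "nat \<Rightarrow> 'v trm \<Rightarrow> 'v trm" where
  "lift k (Var n) = Var (n + k)"
| "lift k (Fn f ts) = Fn f (map (lift k) ts)"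

text \<open>The terms realizing a formula with truth value S.\<close>

definition realizing_terms :: "('v \<Rightarrow> 'v \<Rightarrow> bool) \<Rightarrow> 'v ralg \<Rightarrow> 'v set \<Rightarrow> 'v set" where
  "realizing_terms E \<A> S = {\<xi>. E \<xi> (Terms \<A>) \<and> (\<forall>\<pi>\<in>S. E (proc \<A> \<xi> \<pi>) (Pole \<A>))}"

text \<open>
  The truth values of \<open>a \<notin> b\<close> and \<open>a \<subset> b\<close> are defined by simultaneous recursion on ranks inside the
  ground model:
  \<^item> \<open>\<parallel>a \<notin> b\<parallel> = {\<xi>\<cdot>\<xi>'\<cdot>\<pi> : (c,\<pi>) \<in> b, \<xi> \<tturnstile> a \<subset> c, \<xi>' \<tturnstile> c \<subset> a}\<close>
  \<^item> \<open>\<parallel>a \<subset> b\<parallel> = {\<xi>\<cdot>\<pi> : (c,\<pi>) \<in> a, \<xi> \<tturnstile> c \<notin> b}\<close>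

  The individuals N and S tabulate them, as sets of triples, on a transitive set T.
\<close>

definition table_value :: "('v \<Rightarrow> 'v \<Rightarrow> bool) \<Rightarrow> 'v \<Rightarrow> 'v \<Rightarrow> 'v \<Rightarrow> 'v set" where
  "table_value E N a b = {\<pi>. E (pair E (pair E a b) \<pi>) N}"

definition atomic_tables ::
  "('v \<Rightarrow> 'v \<Rightarrow> bool) \<Rightarrow> 'v ralg \<Rightarrow> 'v \<Rightarrow> 'v \<Rightarrow> 'v \<Rightarrow> bool" where
  "atomic_tables E \<A> T N S \<longleftrightarrow>
     transitive E T \<and>
     (\<forall>a b. E a T \<longrightarrow> E b T \<longrightarrow>
        table_value E N a b =
          {push \<A> \<xi> (push \<A> \<xi>' \<pi>) | \<xi> \<xi>' \<pi> c. E \<pi> (Stacks \<A>) \<and> E (pair E c \<pi>) b \<and>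
             \<xi> \<in> realizing_terms E \<A> (table_value E S a c) \<and>
             \<xi>' \<in> realizing_terms E \<A> (table_value E S c a)} \<and>
        table_value E S a b =
          {push \<A> \<xi> \<pi> | \<xi> \<pi> c. E \<pi> (Stacks \<A>) \<and> E (pair E c \<pi>) a \<and>
             \<xi> \<in> realizing_terms E \<A> (table_value E N c b)})"

primrec truth_value ::
  "('v \<Rightarrow> 'v \<Rightarrow> bool) \<Rightarrow> 'v ralg \<Rightarrow> 'v efm \<Rightarrow> (nat \<Rightarrow> 'v) \<Rightarrow> 'v set" where
  "truth_value E \<A> (NotEps s t) e =
     {\<pi>. E \<pi> (Stacks \<A>) \<and> E (pair E (eval e s) \<pi>) (eval e t)}"
| "truth_value E \<A> (NotIn s t) e =
     {\<pi>. \<exists>T N S. atomic_tables E \<A> T N S \<and> E (eval e s) T \<and> E (eval e t) T \<and>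
        \<pi> \<in> table_value E N (eval e s) (eval e t)}"
| "truth_value E \<A> (Incl s t) e =
     {\<pi>. \<exists>T N S. atomic_tables E \<A> T N S \<and> E (eval e s) T \<and> E (eval e t) T \<and>
        \<pi> \<in> table_value E S (eval e s) (eval e t)}"
| "truth_value E \<A> EFls e = {\<pi>. E \<pi> (Stacks \<A>)}"
| "truth_value E \<A> (EImpl F G) e =
     {push \<A> \<xi> \<pi> | \<xi> \<pi>. \<xi> \<in> realizing_terms E \<A> (truth_value E \<A> F e) \<and> \<pi> \<in> truth_value E \<A> G e}"
| "truth_value E \<A> (EForall F) e = (\<Union>a. truth_value E \<A> F (case_nat a e))"
| "truth_value E \<A> (Guard R ts F) e = (if R (map (eval e) ts) then truth_value E \<A> F e else {})"

definition realized :: "('v \<Rightarrow> 'v \<Rightarrow> bool) \<Rightarrow> 'v ralg \<Rightarrow> 'v efm \<Rightarrow> (nat \<Rightarrow> 'v) \<Rightarrow> bool" where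
  "realized E \<A> F e \<longleftrightarrow> (\<exists>\<theta>. E \<theta> (QP \<A>) \<and> \<theta> \<in> realizing_terms E \<A> (truth_value E \<A> F e))"


section \<open>The structure on the individuals given by \<open>\<D>\<close>\<close>

text \<open>The function symbol of a relation P of the ground model, with values 0 and 1.\<close>

definition char_fn :: "('v \<Rightarrow> 'v \<Rightarrow> bool) \<Rightarrow> ('v list \<Rightarrow> bool) \<Rightarrow> 'v list \<Rightarrow> 'v" where
  "char_fn E P xs = (if P xs then one E else empty E)"

text \<open>The function symbol of a ZF formula, whose i-th free variable is the i-th argument.\<close>

definition formula_fn :: "('v \<Rightarrow> 'v \<Rightarrow> bool) \<Rightarrow> fm \<Rightarrow> 'v list \<Rightarrow> 'v" where
  "formula_fn E F = char_fn E (\<lambda>xs. sat E F (\<lambda>i. xs ! i))"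

definition below_fn :: "('v \<Rightarrow> 'v \<Rightarrow> bool) \<Rightarrow> 'v list \<Rightarrow> 'v" where
  "below_fn E = char_fn E (\<lambda>xs. below E (xs ! 0) (xs ! 1))"

text \<open>The order of the Boolean algebra \<open>{0,1}\<close>, as the relation \<open>xs\<^sub>0 \<ge> xs\<^sub>1\<close>.\<close>

definition bool_ge :: "('v \<Rightarrow> 'v \<Rightarrow> bool) \<Rightarrow> 'v list \<Rightarrow> bool" where
  "bool_ge E xs \<longleftrightarrow> xs ! 0 = one E \<or> xs ! 1 = empty E"

text \<open>\<open>\<D>[\<alpha>] \<equiv> \<forall>X(\<forall>x(\<forall>y(\<langle>y<x\<rangle> \<ge> \<alpha> \<hookrightarrow> y \<notin>\<^sub>\<epsilon> X) \<rightarrow> x \<notin>\<^sub>\<epsilon> X) \<rightarrow> \<forall>x(x \<notin>\<^sub>\<epsilon> X))\<close>, with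
  \<open>\<notin>\<^sub>\<epsilon>\<close> standing for the negated strong membership.\<close>

definition DD :: "('v \<Rightarrow> 'v \<Rightarrow> bool) \<Rightarrow> 'v trm \<Rightarrow> 'v efm" where
  "DD E \<alpha> =
     EForall
       (EImpl
         (EForall
           (EImpl
             (EForall
               (Guard (bool_ge E) [Fn (below_fn E) [Var 0, Var 1], lift 3 \<alpha>]
                 (NotEps (Var 0) (Var 2))))
             (NotEps (Var 0) (Var 1))))
         (EForall (NotEps (Var 0) (Var 1))))"

text \<open>The translation of a ZF formula F into the \<open>ZF\<^sub>\<epsilon>\<close> formula \<open>\<M>\<^sub>\<D> \<Turnstile> F\<close>.\<close>

primrec MD :: "('v \<Rightarrow> 'v \<Rightarrow> bool) \<Rightarrow> fm \<Rightarrow> 'v efm" where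
  "MD E (Mem i j) = DD E (Fn (formula_fn E (Mem 0 1)) [Var i, Var j])"
| "MD E (Eq i j) = DD E (Fn (formula_fn E (Eq 0 1)) [Var i, Var j])"
| "MD E Fls = EFls"
| "MD E (Impl F G) = EImpl (MD E F) (MD E G)"
| "MD E (Forall F) = EForall (MD E F)"

end

theory Submission
  imports Defs
begin

text \<open>
  Truth in \<open>\<M>\<^sub>\<D>\<close> obeys a Los theorem: \<open>\<M>\<^sub>\<D> \<Turnstile> F\<close> and \<open>\<D>[\<langle>F\<rangle>]\<close> imply each other by realizers that depend
  on F only.  The quantifier step is immediate, since a counterexample may be chosen in the ground model
  for each valuation.  The implication step needs that \<open>\<D>\<close> behaves as an ultrafilter, uniformly in the
  arguments from \<open>{0,1}\<close>.

  If neither \<open>\<langle>y<x\<rangle> \<ge> b\<close> nor \<open>\<langle>y<x\<rangle> \<ge> \<not>b\<close> were well-founded, merging coordinates would give a descent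
  for \<open>\<langle>y<x\<rangle> = 1\<close>; this realizes \<open>\<D>[b] \<or> \<D>[\<not>b]\<close>.

  Conversely, realizers of \<open>\<D>[a]\<close>, \<open>\<D>[b]\<close>, \<open>\<D>[c]\<close> with one of a, b, c equal to 0 must be contradictory
  without knowing which one.  Classically, two well-founded orders would bound each other's ranks.
  With one of the orders degenerate, the truth value of the statement that x bounds all ranks of the
  degenerate side is \<open>psi x\<close>, and that of the statement that x is bounded by a rank of that side is
  \<open>phi x = \<not> psi x\<close>; here \<open>psi x\<close> results from iterating a double negation along x.  The iteration
  stabilizes because there are more ordinals than sets of terms, and at the stable stage one and the
  same term extracts \<open>psi x\<close> from \<open>\<D>[0]\<close> and \<open>phi x\<close> from \<open>\<D>[1]\<close>.
  A term unfolding its arguments in turn then refutes any combination containing a \<open>psi x\<close>.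
\<close>

section \<open>Definability in a structure\<close>

primrec ren :: "(nat \<Rightarrow> nat) \<Rightarrow> fm \<Rightarrow> fm" where
  "ren r (Mem i j) = Mem (r i) (r j)"
| "ren r (Eq i j) = Eq (r i) (r j)"
| "ren r Fls = Fls"
| "ren r (Impl F G) = Impl (ren r F) (ren r G)"
| "ren r (Forall F) = Forall (ren (case_nat 0 (\<lambda>n. Suc (r n))) F)"

lemma sat_ren: "sat E (ren r F) e \<longleftrightarrow> sat E F (\<lambda>n. e (r n))"
proof (induction F arbitrary: r e)
  case (Forall F)
  have "(\<lambda>n. case_nat a e (case_nat 0 (\<lambda>n. Suc (r n)) n)) = case_nat a (\<lambda>n. e (r n))" for a
    by (auto split: nat.split)
  with Forall show ?case by simp
qed auto

definition mix :: "(nat \<Rightarrow> 'v) \<Rightarrow> (nat \<Rightarrow> 'v) \<Rightarrow> nat \<Rightarrow> 'v" where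
  "mix e c = (\<lambda>i. if even i then e (i div 2) else c (i div 2))"

text \<open>The variables sit at the even indices and the parameters c at the odd ones.\<close>

definition definable :: "('v \<Rightarrow> 'v \<Rightarrow> bool) \<Rightarrow> ((nat \<Rightarrow> 'v) \<Rightarrow> bool) \<Rightarrow> bool" where
  "definable E P \<longleftrightarrow> (\<exists>F c. \<forall>e. P e \<longleftrightarrow> sat E F (mix e c))"

text \<open>The value sits at variable 0, the slot that \<open>definable_ex\<close> binds, so that a
  term is substituted by quantifying over its value.\<close>

definition dterm :: "('v \<Rightarrow> 'v \<Rightarrow> bool) \<Rightarrow> ((nat \<Rightarrow> 'v) \<Rightarrow> 'v) \<Rightarrow> bool" where
  "dterm E t \<longleftrightarrow> definable E (\<lambda>e. e 0 = t (\<lambda>n. e (Suc n)))"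

section \<open>Closure of definable predicates under logical operations\<close>

lemma definable_ren:
  assumes "definable E P"
  shows "definable E (\<lambda>e. P (\<lambda>n. e (r n)))"
proof -
  obtain F c where F: "\<And>e. P e \<longleftrightarrow> sat E F (mix e c)"
    using assms unfolding definable_def by blast
  define s where "s i = (if even i then 2 * r (i div 2) else i)" for i
  have "(\<lambda>n. mix e c (s n)) = mix (\<lambda>n. e (r n)) c" for e
    by (auto simp: mix_def s_def)
  then have "P (\<lambda>n. e (r n)) \<longleftrightarrow> sat E (ren s F) (mix e c)" for e
    by (simp add: F sat_ren)
  then show ?thesis unfolding definable_def by blast
qed

lemma definable_imp:
  assumes "definable E P" "definable E Q"
  shows "definable E (\<lambda>e. P e \<longrightarrow> Q e)"
proof -
  obtain F c where F: "\<And>e. P e \<longleftrightarrow> sat E F (mix e c)"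
    using assms unfolding definable_def by blast
  obtain G d where G: "\<And>e. Q e \<longleftrightarrow> sat E G (mix e d)"
    using assms unfolding definable_def by blast
  \<comment> \<open>Variables stay; parameter k of c becomes parameter 2k of \<open>mix c d\<close>,
    and parameter k of d becomes 2k + 1.\<close>
  define s where "s i = (if even i then i else Suc (2 * (2 * (i div 2))))" for i :: nat
  define t where "t i = (if even i then i else Suc (2 * Suc (2 * (i div 2))))" for i :: nat
  have "(\<lambda>n. mix e (mix c d) (s n)) = mix e c" for e
    by (rule ext, case_tac "even n") (auto simp: s_def mix_def elim!: oddE)
  moreover have "(\<lambda>n. mix e (mix c d) (t n)) = mix e d" for e
    by (rule ext, case_tac "even n") (auto simp: t_def mix_def elim!: oddE)
  ultimately have "(P e \<longrightarrow> Q e) \<longleftrightarrow> sat E (Impl (ren s F) (ren t G)) (mix e (mix c d))" for e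
    by (simp add: F G sat_ren)
  then show ?thesis unfolding definable_def by blast
qed

lemma definable_all:
  assumes "definable E (\<lambda>e. Q (\<lambda>n. e (Suc n)) (e 0))"
  shows "definable E (\<lambda>e. \<forall>a. Q e a)"
proof -
  obtain F c where F: "\<And>e. Q (\<lambda>n. e (Suc n)) (e 0) \<longleftrightarrow> sat E F (mix e c)"
    using assms unfolding definable_def by blast
  \<comment> \<open>Under the quantifier, index 0 is bound and all indices of \<open>mix e c\<close>
    are raised by one. Variable k > 0 was variable k - 1, whence i - 2 + 1 for even i.\<close>
  define s where "s i = (if i = 0 then 0 else if even i then i - 1 else Suc i)" for i :: nat
  have "(\<lambda>n. case_nat a (mix e c) (s n)) = mix (case_nat a e) c" for a e
  proof (rule ext)
    fix n show "case_nat a (mix e c) (s n) = mix (case_nat a e) c n"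
      by (cases "n = 0"; cases "even n") (auto simp: s_def mix_def elim!: evenE split: nat.split)
  qed
  then have "(\<forall>a. Q e a) \<longleftrightarrow> sat E (Forall (ren s F)) (mix e c)" for e
    using F[of "case_nat _ e"] by (simp add: sat_ren)
  then show ?thesis unfolding definable_def by blast
qed

lemma definable_const: "definable E (\<lambda>e. Q)"
proof -
  have "Q \<longleftrightarrow> sat E (if Q then Impl Fls Fls else Fls) (mix e c)" for e c by simp
  then show ?thesis unfolding definable_def by metis
qed

lemma definable_cong: "definable E P \<Longrightarrow> (\<And>e. P e = Q e) \<Longrightarrow> definable E Q"
  by (simp add: definable_def)

lemma definable_not:
  assumes "definable E P" shows "definable E (\<lambda>e. \<not> P e)"
  by (rule definable_cong[OF definable_imp[OF assms definable_const[of E False]]]) simp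

lemma definable_conj:
  assumes "definable E P" "definable E Q" shows "definable E (\<lambda>e. P e \<and> Q e)"
  by (rule definable_cong[OF definable_not[OF definable_imp[OF assms(1) definable_not[OF assms(2)]]]])
    simp

lemma definable_disj:
  assumes "definable E P" "definable E Q" shows "definable E (\<lambda>e. P e \<or> Q e)"
  by (rule definable_cong[OF definable_imp[OF definable_not[OF assms(1)] assms(2)]]) auto

lemma definable_iff:
  assumes "definable E P" "definable E Q" shows "definable E (\<lambda>e. P e \<longleftrightarrow> Q e)"
  by (rule definable_cong[OF definable_conj[OF definable_imp[OF assms] definable_imp[OF assms(2,1)]]])
    auto

lemma definable_ex:
  assumes "definable E (\<lambda>e. Q (\<lambda>n. e (Suc n)) (e 0))"
  shows "definable E (\<lambda>e. \<exists>a. Q e a)"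
  by (rule definable_cong[OF definable_not[OF definable_all[OF definable_not[OF assms]]]]) simp

lemma definable_if:
  assumes "definable E P" "definable E Q" "definable E R"
  shows "definable E (\<lambda>e. if P e then Q e else R e)"
  by (rule definable_cong[OF definable_conj[OF definable_imp[OF assms(1,2)]
          definable_imp[OF definable_not[OF assms(1)] assms(3)]]]) auto

section \<open>Definable functions and substitution\<close>

lemma dterm_var: "dterm E (\<lambda>e. e i)"
proof -
  have "mix e (\<lambda>_. undefined) 0 = e 0" "mix e (\<lambda>_. undefined) (2 * Suc i) = e (Suc i)" for e :: "nat \<Rightarrow> 'a"
    by (auto simp: mix_def)
  then have "e 0 = e (Suc i) \<longleftrightarrow> sat E (Eq 0 (2 * Suc i)) (mix e (\<lambda>_. undefined))" for e
    by simp
  then show ?thesis unfolding dterm_def definable_def by blast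
qed

lemma dterm_const: "dterm E (\<lambda>e. a)"
proof -
  have "e 0 = a \<longleftrightarrow> sat E (Eq 0 1) (mix e (\<lambda>_. a))" for e
    by (simp add: mix_def)
  then show ?thesis unfolding dterm_def definable_def by blast
qed

lemma dterm_ren:
  assumes "dterm E t" shows "dterm E (\<lambda>e. t (\<lambda>n. e (r n)))"
  using definable_ren[OF assms[unfolded dterm_def], of "case_nat 0 (\<lambda>n. Suc (r n))"]
  by (simp add: dterm_def)

lemma definable_subst1:
  assumes R: "definable E (\<lambda>e. R (e 0))" and s: "dterm E s"
  shows "definable E (\<lambda>e. R (s e))"
proof -
  have "definable E (\<lambda>e. \<exists>a. a = s e \<and> R a)"
    by (rule definable_ex, rule definable_conj) (use s R in \<open>auto simp: dterm_def\<close>)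
  then show ?thesis by simp
qed

lemma definable_subst2:
  assumes R: "definable E (\<lambda>e. R (e 0) (e 1))" and s: "dterm E s" and t: "dterm E t"
  shows "definable E (\<lambda>e. R (s e) (t e))"
proof -
  have "definable E (\<lambda>e. R (e 1) (e 0))"
    using definable_ren[OF R, of "\<lambda>n. if n = 0 then 1 else 0"] by simp
  then have R': "definable E (\<lambda>e. R (e (Suc 0)) (e 0))" by simp
  have "definable E (\<lambda>e. \<exists>a. a = s e \<and> (\<exists>b. b = t e \<and> R a b))"
    apply (rule definable_ex, rule definable_conj)
    using s apply (simp add: dterm_def)
    apply (rule definable_ex, rule definable_conj)
    using dterm_ren[OF t, of Suc] apply (simp add: dterm_def)
    by (rule R')
  then show ?thesis by simp
qed

lemma definable_subst3:
  assumes R: "definable E (\<lambda>e. R (e 0) (e 1) (e 2))"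
    and s: "dterm E s" and t: "dterm E t" and u: "dterm E u"
  shows "definable E (\<lambda>e. R (s e) (t e) (u e))"
proof -
  have "definable E (\<lambda>e. R (e 2) (e 1) (e 0))"
    using definable_ren[OF R, of "\<lambda>n. if n = 0 then 2 else if n = 1 then 1 else 0"] by simp
  then have R': "definable E (\<lambda>e. R (e (Suc (Suc 0))) (e (Suc 0)) (e 0))"
    by (simp add: numeral_2_eq_2)
  have "definable E (\<lambda>e. \<exists>a. a = s e \<and> (\<exists>b. b = t e \<and> (\<exists>c. c = u e \<and> R a b c)))"
    apply (rule definable_ex, rule definable_conj)
    using s apply (simp add: dterm_def)
    apply (rule definable_ex, rule definable_conj)
    using dterm_ren[OF t, of Suc] apply (simp add: dterm_def)
    apply (rule definable_ex, rule definable_conj)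
    using dterm_ren[OF u, of "\<lambda>n. Suc (Suc n)"] apply (simp add: dterm_def)
    by (rule R')
  then show ?thesis by simp
qed

lemma definable_eq: "dterm E s \<Longrightarrow> dterm E t \<Longrightarrow> definable E (\<lambda>e. s e = t e)"
  by (rule definable_subst2[where R = "(=)"]) (use dterm_var[of E 0] in \<open>simp_all add: dterm_def\<close>)

lemma definable_mem: "dterm E s \<Longrightarrow> dterm E t \<Longrightarrow> definable E (\<lambda>e. E (s e) (t e))"
proof (rule definable_subst2[where R = E])
  have "E (e 0) (e 1) \<longleftrightarrow> sat E (Mem 0 2) (mix e c)" for e c by (simp add: mix_def)
  then show "definable E (\<lambda>e. E (e 0) (e 1))" unfolding definable_def by blast
qed

lemma dterm_fun2:
  assumes "definable E (\<lambda>e. e 0 = f (e 1) (e 2))" "dterm E s" "dterm E t"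
  shows "dterm E (\<lambda>e. f (s e) (t e))"
  unfolding dterm_def
  by (rule definable_subst3[where R = "\<lambda>x y z. x = f y z", OF assms(1) dterm_var])
    (use dterm_ren[OF assms(2), of Suc] dterm_ren[OF assms(3), of Suc] in simp_all)

text \<open>Used backwards, these rules reduce definability to atoms, as separation, replacement and
  internal induction require.\<close>

named_theorems dfn
lemmas [dfn] = definable_const definable_imp definable_conj definable_disj
  definable_iff definable_not definable_if definable_all definable_ex definable_eq definable_mem
  dterm_var dterm_const

section \<open>Set theory in the ground model\<close>

locale zf =
  fixes E :: "'v \<Rightarrow> 'v \<Rightarrow> bool"
  assumes zf_model: "zf_model E"
begin

section \<open>The axioms of ZF for definable predicates and relations\<close>

lemma extensionality: "(\<And>x. E x a \<longleftrightarrow> E x b) \<Longrightarrow> a = b"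
proof -
  have "\<forall>a b. (\<forall>x. E x a \<longleftrightarrow> E x b) \<longrightarrow> a = b"
    using zf_model unfolding zf_model_def by (elim conjE)
  then show "(\<And>x. E x a \<longleftrightarrow> E x b) \<Longrightarrow> a = b" by blast
qed

lemma foundation: "E x a \<Longrightarrow> \<exists>x. E x a \<and> (\<forall>y. E y x \<longrightarrow> \<not> E y a)"
proof -
  have "\<forall>a. (\<exists>x. E x a) \<longrightarrow> (\<exists>x. E x a \<and> (\<forall>y. E y x \<longrightarrow> \<not> E y a))"
    using zf_model unfolding zf_model_def by (elim conjE)
  then show "E x a \<Longrightarrow> \<exists>x. E x a \<and> (\<forall>y. E y x \<longrightarrow> \<not> E y a)" by blast
qed

lemma pairing: "\<exists>c. \<forall>x. E x c \<longleftrightarrow> x = a \<or> x = b"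
proof -
  have "\<forall>a b. \<exists>c. \<forall>x. E x c \<longleftrightarrow> x = a \<or> x = b"
    using zf_model unfolding zf_model_def by (elim conjE)
  then show ?thesis by blast
qed

lemma union: "\<exists>u. \<forall>x. E x u \<longleftrightarrow> (\<exists>y. E x y \<and> E y a)"
proof -
  have "\<forall>a. \<exists>u. \<forall>x. E x u \<longleftrightarrow> (\<exists>y. E x y \<and> E y a)"
    using zf_model unfolding zf_model_def by (elim conjE)
  then show ?thesis by blast
qed

lemma powerset: "\<exists>p. \<forall>x. E x p \<longleftrightarrow> subset E x a"
proof -
  have "\<forall>a. \<exists>p. \<forall>x. E x p \<longleftrightarrow> subset E x a"
    using zf_model unfolding zf_model_def by (elim conjE)
  then show ?thesis by blast
qed

lemma separation:
  assumes "definable E (\<lambda>e. P (e 0))"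
  shows "\<exists>b. \<forall>x. E x b \<longleftrightarrow> E x a \<and> P x"
proof -
  obtain F c where F: "\<And>e. P (e 0) \<longleftrightarrow> sat E F (mix e c)"
    using assms unfolding definable_def by blast
  \<comment> \<open>As P depends on variable 0 only, every variable may be read as x; the remaining
    indices hold the parameters.\<close>
  define r where "r i = (if even i then 0 else Suc (i div 2))" for i :: nat
  have "(\<lambda>n. case_nat x c (r n)) = mix (\<lambda>_. x) c" for x
    by (auto simp: r_def mix_def)
  then have "sat E (ren r F) (case_nat x c) \<longleftrightarrow> P x" for x
    using F[of "\<lambda>_. x"] by (simp add: sat_ren)
  moreover have "\<forall>F e a. \<exists>b. \<forall>x. E x b \<longleftrightarrow> E x a \<and> sat E F (case_nat x e)"
    using zf_model unfolding zf_model_def by (elim conjE)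
  then have "\<exists>b. \<forall>x. E x b \<longleftrightarrow> E x a \<and> sat E (ren r F) (case_nat x c)" by blast
  ultimately show ?thesis by simp
qed

lemma replacement:
  assumes "definable E (\<lambda>e. R (e 0) (e 1))"
    and functional: "\<And>x y y'. E x a \<Longrightarrow> R x y \<Longrightarrow> R x y' \<Longrightarrow> y = y'"
  shows "\<exists>b. \<forall>y. E y b \<longleftrightarrow> (\<exists>x. E x a \<and> R x y)"
proof -
  obtain F c where F: "\<And>e. R (e 0) (e 1) \<longleftrightarrow> sat E F (mix e c)"
    using assms(1) unfolding definable_def by blast
  \<comment> \<open>The schema has y at index 0, x at index 1 and parameters from index 2 on; all
    variables except the first are read as y.\<close>
  define r where "r i = (if i = 0 then 1 else if even i then 0 else Suc (Suc (i div 2)))" for i :: nat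
  have "(\<lambda>n. case_nat y (case_nat x c) (r n)) = mix (case_nat x (\<lambda>_. y)) c" for x y
  proof
    fix n show "case_nat y (case_nat x c) (r n) = mix (case_nat x (\<lambda>_. y)) c n"
      by (cases "n div 2") (auto simp: r_def mix_def elim: oddE)
  qed
  then have sat_iff: "sat E (ren r F) (case_nat y (case_nat x c)) \<longleftrightarrow> R x y" for x y
    using F[of "case_nat x (\<lambda>_. y)"] by (simp add: sat_ren)
  have "\<forall>F e a. (\<forall>x y y'. E x a \<longrightarrow> sat E F (case_nat y (case_nat x e)) \<longrightarrow>
           sat E F (case_nat y' (case_nat x e)) \<longrightarrow> y = y') \<longrightarrow>
        (\<exists>b. \<forall>y. E y b \<longleftrightarrow> (\<exists>x. E x a \<and> sat E F (case_nat y (case_nat x e))))"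
    using zf_model unfolding zf_model_def by (elim conjE)
  from this[THEN spec, of "ren r F", THEN spec, of c, THEN spec, of a]
  show ?thesis unfolding sat_iff using functional by blast
qed

section \<open>Comprehension terms, pairs and relations\<close>

lemma in_mset:
  assumes "\<exists>a. \<forall>x. E x a \<longleftrightarrow> P x"
  shows "E x (mset E P) \<longleftrightarrow> P x"
proof -
  obtain a where a: "\<forall>x. E x a \<longleftrightarrow> P x" using assms ..
  have "\<exists>!a. \<forall>x. E x a \<longleftrightarrow> P x"
    by (rule ex1I[where a = a]) (use a in \<open>auto intro: extensionality\<close>)
  from theI'[OF this] show ?thesis by (simp add: mset_def)
qed

lemma in_empty [simp]: "\<not> E x (empty E)"
proof -
  have "\<exists>a. \<forall>x. E x a \<longleftrightarrow> False"
    using separation[OF definable_const[of E False]] by simp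
  from in_mset[OF this] show ?thesis unfolding empty_def by simp
qed

lemma in_upair [simp]: "E x (upair E a b) \<longleftrightarrow> x = a \<or> x = b"
  unfolding upair_def by (rule in_mset[OF pairing])

lemma upair_inject: "upair E a b = upair E c d \<longleftrightarrow> a = c \<and> b = d \<or> a = d \<and> b = c"
proof
  assume "upair E a b = upair E c d"
  then have "E x (upair E a b) \<longleftrightarrow> E x (upair E c d)" for x by simp
  then have *: "x = a \<or> x = b \<longleftrightarrow> x = c \<or> x = d" for x by simp
  show "a = c \<and> b = d \<or> a = d \<and> b = c"
    using *[of a] *[of b] *[of c] *[of d] by fast
next
  assume "a = c \<and> b = d \<or> a = d \<and> b = c"
  then show "upair E a b = upair E c d" by (intro extensionality) auto
qed

lemma pair_inject [simp]: "pair E a b = pair E c d \<longleftrightarrow> a = c \<and> b = d"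
  unfolding pair_def upair_inject by blast

lemma one_neq_empty [simp]: "one E \<noteq> empty E" "empty E \<noteq> one E"
proof -
  have "E (empty E) (one E)" by (simp add: one_def)
  then show "one E \<noteq> empty E" by auto
  then show "empty E \<noteq> one E" by simp
qed

lemma mem_irrefl: "\<not> E x x"
  using foundation[of x "upair E x x"] by auto

lemma dterm_upair: "dterm E s \<Longrightarrow> dterm E t \<Longrightarrow> dterm E (\<lambda>e. upair E (s e) (t e))"
proof (rule dterm_fun2[where f = "upair E"])
  have "x = upair E a b \<longleftrightarrow> (\<forall>z. E z x \<longleftrightarrow> z = a \<or> z = b)" for x a b
    using in_upair extensionality by metis
  then show "definable E (\<lambda>e. e 0 = upair E (e 1) (e 2))"
    by simp (intro dfn)
qed

lemma dterm_pair [dfn]: "dterm E s \<Longrightarrow> dterm E t \<Longrightarrow> dterm E (\<lambda>e. pair E (s e) (t e))"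
  unfolding pair_def by (intro dterm_upair)

lemma definable_subset [dfn]:
  "dterm E s \<Longrightarrow> dterm E t \<Longrightarrow> definable E (\<lambda>e. subset E (s e) (t e))"
  by (rule definable_subst2[where R = "subset E"]) (unfold subset_def, intro dfn)

lemma definable_transitive [dfn]:
  "dterm E s \<Longrightarrow> definable E (\<lambda>e. transitive E (s e))"
  by (rule definable_subst1[where R = "transitive E"]) (unfold transitive_def, intro dfn)

lemma definable_ordinal [dfn]:
  "dterm E s \<Longrightarrow> definable E (\<lambda>e. ordinal E (s e))"
  by (rule definable_subst1[where R = "ordinal E"]) (unfold ordinal_def, intro dfn)

lemma definable_below [dfn]:
  "dterm E s \<Longrightarrow> dterm E t \<Longrightarrow> definable E (\<lambda>e. below E (s e) (t e))"
  by (rule definable_subst2[where R = "below E"]) (unfold below_def, intro dfn)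

text \<open>Kuratowski pairs of elements of a and b lie in the double power set of their union, so
  separation suffices.\<close>

lemma relation_set:
  assumes R: "definable E (\<lambda>e. R (e 0) (e 1))"
  shows "\<exists>g. \<forall>x y. E (pair E x y) g \<longleftrightarrow> E x a \<and> E y b \<and> R x y"
proof -
  obtain c where c: "\<And>x. E x c \<longleftrightarrow> (\<exists>y. E x y \<and> E y (upair E a b))"
    using union by blast
  obtain p where p: "\<And>x. E x p \<longleftrightarrow> subset E x c" using powerset by blast
  obtain q where q: "\<And>x. E x q \<longleftrightarrow> subset E x p" using powerset by blast
  have "definable E (\<lambda>e. \<exists>x. E x a \<and> (\<exists>y. E y b \<and> R x y \<and> e 0 = pair E x y))"
    by (intro dfn definable_subst2[where R = R, OF R])
  then obtain g where g: "\<And>z. E z g \<longleftrightarrow> E z q \<and> (\<exists>x. E x a \<and> (\<exists>y. E y b \<and> R x y \<and> z = pair E x y))"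
    using separation[where P = "\<lambda>z. \<exists>x. E x a \<and> (\<exists>y. E y b \<and> R x y \<and> z = pair E x y)"] by blast
  have "E (pair E x y) q" if "E x a" "E y b" for x y
    using that by (auto simp: q p c pair_def subset_def)
  then show ?thesis using g by (auto intro!: exI[of _ g])
qed

end

locale zf_constructible = zf +
  assumes V_equals_L: "V_equals_L E"
begin

text \<open>As the levels \<open>L\<^sub>\<beta>\<close> are transitive, \<open>V = L\<close> spares the recursion that constructs transitive closures.\<close>

lemma ex_transitive: "\<exists>T. transitive E T \<and> E x T"
proof -
  obtain \<alpha> f \<beta> where f: "constructible_levels E \<alpha> f" "E \<beta> \<alpha>" "E x (app E f \<beta>)"
    using V_equals_L unfolding V_equals_L_def by blast
  have lev: "E x (app E f \<beta>) \<longleftrightarrow> (\<exists>\<gamma>. E \<gamma> \<beta> \<and> definable_subset E (app E f \<gamma>) x)"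
    if "E \<beta> \<alpha>" for \<beta> x
    using f(1) that unfolding constructible_levels_def by blast
  have ord: "ordinal E \<alpha>" using f(1) unfolding constructible_levels_def by blast
  have sub: "E y (app E f \<gamma>)" if "definable_subset E (app E f \<gamma>) z" "E y z" for \<gamma> y z
    using that unfolding definable_subset_def by blast
  \<comment> \<open>Transitivity of the level: z is included in an earlier level, so y is definable
    over a still earlier one.\<close>
  have "E y (app E f \<beta>)" if yz: "E y z" and z: "E z (app E f \<beta>)" for y z
  proof -
    obtain \<gamma> where \<gamma>: "E \<gamma> \<beta>" "definable_subset E (app E f \<gamma>) z"
      using z lev f(2) by blast
    have "E \<gamma> \<alpha>"
      using ord f(2) \<gamma>(1) unfolding ordinal_def transitive_def subset_def by blast
    then obtain \<delta> where \<delta>: "E \<delta> \<gamma>" "definable_subset E (app E f \<delta>) y"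
      using lev sub[OF \<gamma>(2) yz] by blast
    moreover have "E \<delta> \<beta>"
      using ord f(2) \<gamma>(1) \<delta>(1) unfolding ordinal_def transitive_def subset_def by blast
    ultimately show ?thesis using lev f(2) by blast
  qed
  then show ?thesis using f(3) unfolding transitive_def subset_def by blast
qed

section \<open>Transitive closure and internal induction\<close>

lemma mem_below: "E y x \<Longrightarrow> below E y x"
  unfolding below_def subset_def by blast

lemma below_trans: "below E z y \<Longrightarrow> below E y x \<Longrightarrow> below E z x"
  unfolding below_def transitive_def by blast

lemma below_transitive: "transitive E T \<Longrightarrow> E x T \<Longrightarrow> below E y x \<Longrightarrow> E y T"
  unfolding below_def transitive_def by blast

text \<open>Foundation concerns membership only. A membership-minimal w among the points of T with a
  counterexample at or below them turns out to have none strictly below, so the induction step gives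
  P at w as well.\<close>

lemma below_induct:
  assumes P: "definable E (\<lambda>e. P (e 0))"
    and step: "\<And>x. (\<And>y. below E y x \<Longrightarrow> P y) \<Longrightarrow> P x"
  shows "P x"
proof (rule ccontr)
  assume nP: "\<not> P x"
  have "definable E (\<lambda>e. \<exists>z. \<not> P z \<and> (z = e 0 \<or> below E z (e 0)))"
    by (intro dfn definable_subst1[where R = P, OF P])
  then have Q: "definable E (\<lambda>e. (\<lambda>w. \<exists>z. \<not> P z \<and> (z = w \<or> below E z w)) (e 0))" .
  obtain T where T: "transitive E T" "E x T" using ex_transitive by blast
  obtain b where b: "\<And>w. E w b \<longleftrightarrow> E w T \<and> (\<exists>z. \<not> P z \<and> (z = w \<or> below E z w))"
    using separation[OF Q] by blast
  have "E x b" using b T nP by blast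
  then obtain w where w: "E w b" "\<And>y. E y w \<Longrightarrow> \<not> E y b" using foundation by blast
  have wT: "E w T" using w b by blast
  have P_below: "P z" if "below E z w" for z
  proof (rule ccontr)
    assume "\<not> P z"
    \<comment> \<open>The points of T without counterexample at or below them form a transitive set
      including w, hence containing all that is below w.\<close>
    have "definable E (\<lambda>e. (\<lambda>w. \<not> (\<exists>z. \<not> P z \<and> (z = w \<or> below E z w))) (e 0))"
      by (intro dfn definable_subst1[where R = P, OF P])
    from separation[OF this, of T] obtain S where
      S: "\<And>y. E y S \<longleftrightarrow> E y T \<and> \<not> (\<exists>z. \<not> P z \<and> (z = y \<or> below E z y))" by blast
    have "transitive E S"
      using T(1) below_trans mem_below unfolding transitive_def subset_def S by blast
    moreover have "subset E w S"
      using w(2) b wT T(1) unfolding transitive_def subset_def S by blast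
    ultimately have "E z S" using that unfolding below_def by blast
    then show False using S \<open>\<not> P z\<close> by blast
  qed
  then have "P w" using step by blast
  moreover obtain z where "\<not> P z" "z = w \<or> below E z w" using w b by blast
  ultimately show False using P_below by blast
qed

lemma mem_induct:
  assumes "definable E (\<lambda>e. P (e 0))" "\<And>x. (\<And>y. E y x \<Longrightarrow> P y) \<Longrightarrow> P x"
  shows "P x"
  using below_induct[of P] assms mem_below by blast

section \<open>Ordinals\<close>

lemma ordinal_mem: "ordinal E a \<Longrightarrow> E b a \<Longrightarrow> ordinal E b"
  unfolding ordinal_def transitive_def subset_def by blast

lemma ordinal_trans: "ordinal E a \<Longrightarrow> E c b \<Longrightarrow> E b a \<Longrightarrow> E c a"
  unfolding ordinal_def transitive_def subset_def by blast

text \<open>Double induction: if a and b were incomparable, the elements of each would lie in the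
  other, whence a = b.\<close>

lemma ordinal_linear: "ordinal E a \<Longrightarrow> ordinal E b \<Longrightarrow> E a b \<or> a = b \<or> E b a"
proof -
  have d: "definable E (\<lambda>e. (\<lambda>a. ordinal E a \<longrightarrow> (\<forall>b. ordinal E b \<longrightarrow> E a b \<or> a = b \<or> E b a)) (e 0))"
    by (intro dfn)
  have "ordinal E a \<longrightarrow> (\<forall>b. ordinal E b \<longrightarrow> E a b \<or> a = b \<or> E b a)"
  proof (rule mem_induct[OF d], intro impI allI)
    fix a b assume IHa: "\<And>a'. E a' a \<Longrightarrow> ordinal E a' \<longrightarrow> (\<forall>b. ordinal E b \<longrightarrow> E a' b \<or> a' = b \<or> E b a')"
      and a: "ordinal E a" and b: "ordinal E b"
    have d: "definable E (\<lambda>e. (\<lambda>b. ordinal E b \<longrightarrow> E a b \<or> a = b \<or> E b a) (e 0))"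
      by (intro dfn)
    have "ordinal E b \<longrightarrow> E a b \<or> a = b \<or> E b a"
    proof (rule mem_induct[OF d], intro impI)
      fix b assume IHb: "\<And>b'. E b' b \<Longrightarrow> ordinal E b' \<longrightarrow> E a b' \<or> a = b' \<or> E b' a"
        and b: "ordinal E b"
      show "E a b \<or> a = b \<or> E b a"
      proof (rule ccontr)
        assume n: "\<not> (E a b \<or> a = b \<or> E b a)"
        have "E x b" if "E x a" for x
          using IHa[OF that] n that a b ordinal_mem ordinal_trans by blast
        moreover have "E x a" if "E x b" for x
          using IHb[OF that] n that a b ordinal_mem ordinal_trans by blast
        ultimately show False using n extensionality[of a b] by blast
      qed
    qed
    then show "E a b \<or> a = b \<or> E b a" using b by blast
  qed
  then show "ordinal E a \<Longrightarrow> ordinal E b \<Longrightarrow> E a b \<or> a = b \<or> E b a" by blast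
qed

text \<open>The Burali-Forti argument: such a set would be an ordinal and thus an element of
  itself.\<close>

lemma no_set_of_ordinals: "\<not> (\<forall>a. E a c \<longleftrightarrow> ordinal E a)"
proof
  assume c: "\<forall>a. E a c \<longleftrightarrow> ordinal E a"
  then have "ordinal E c"
    using ordinal_mem unfolding ordinal_def[of E c] transitive_def[of E c] subset_def
    by (metis ordinal_def)
  then show False using c mem_irrefl by blast
qed

text \<open>Otherwise replacement would collect all ordinals in a set.\<close>

lemma ordinal_collision:
  assumes R: "definable E (\<lambda>e. R (e 0) (e 1))"
    and total: "\<And>a. ordinal E a \<Longrightarrow> \<exists>z. E z b \<and> R z a"
  shows "\<exists>z a a'. R z a \<and> R z a' \<and> ordinal E a \<and> E a' a"
proof (rule ccontr)
  assume n: "\<not> ?thesis"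
  define R' where "R' z a \<longleftrightarrow> ordinal E a \<and> R z a" for z a
  have "definable E (\<lambda>e. R' (e 0) (e 1))"
    unfolding R'_def by (intro dfn R)
  \<comment> \<open>Of two distinct ordinals one is an element of the other, so the absence of
    collisions makes \<open>R'\<close> functional.\<close>
  moreover have "a = a'" if "R' z a" "R' z a'" for z a a'
    using n that ordinal_linear[of a a'] unfolding R'_def by blast
  ultimately obtain c where "\<And>a. E a c \<longleftrightarrow> (\<exists>z. E z b \<and> R' z a)"
    using replacement[of R' b] by blast
  then have "\<forall>a. E a c \<longleftrightarrow> ordinal E a" using total R'_def by blast
  then show False using no_set_of_ordinals by blast
qed

end

section \<open>Realizability\<close>

locale realizability_model = zf_constructible E for E :: "'v \<Rightarrow> 'v \<Rightarrow> bool" +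
  fixes \<A> :: "'v ralg"
  assumes realizability_algebra: "realizability_algebra E \<A>"
begin

abbreviation is_term :: "'v \<Rightarrow> bool" where "is_term \<xi> \<equiv> E \<xi> (Terms \<A>)"
abbreviation is_stack :: "'v \<Rightarrow> bool" where "is_stack \<pi> \<equiv> E \<pi> (Stacks \<A>)"
abbreviation prooflike :: "'v \<Rightarrow> bool" where "prooflike \<xi> \<equiv> E \<xi> (QP \<A>)"

text \<open>\<open>psh\<close> and \<open>star\<close> are the total, hence definable, versions of \<open>push\<close> and of
  \<open>\<xi> \<star> \<pi> \<in> \<bottom>\<bottom>\<close>: the operations of \<open>\<A>\<close> are arbitrary outside of terms and stacks.\<close>

definition psh :: "'v \<Rightarrow> 'v \<Rightarrow> 'v" where
  "psh \<xi> \<pi> = (if is_term \<xi> \<and> is_stack \<pi> then push \<A> \<xi> \<pi> else empty E)"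

definition star :: "'v \<Rightarrow> 'v \<Rightarrow> bool" where
  "star \<xi> \<pi> \<longleftrightarrow> is_term \<xi> \<and> is_stack \<pi> \<and> E (proc \<A> \<xi> \<pi>) (Pole \<A>)"

text \<open>The graph of f on A and B is a set g of the ground model and serves as a
  parameter.\<close>

lemma definable_op2:
  assumes "internal_op2 E A B C f"
  shows "definable E (\<lambda>e. E (e 1) A \<and> E (e 2) B \<and> e 0 = f (e 1) (e 2))"
proof -
  obtain g where g: "\<And>p. E p g \<longleftrightarrow> (\<exists>x y. E x A \<and> E y B \<and> p = pair E (pair E x y) (f x y))"
    using assms unfolding internal_op2_def by blast
  have "definable E (\<lambda>e. E (pair E (pair E (e 1) (e 2)) (e 0)) g)" by (intro dfn)
  then show ?thesis by (rule definable_cong) (auto simp: g)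
qed

section \<open>Closure properties of the algebra\<close>

lemma term_ap [simp]: "is_term \<xi> \<Longrightarrow> is_term \<eta> \<Longrightarrow> is_term (ap \<A> \<xi> \<eta>)"
  using realizability_algebra by (auto simp: realizability_algebra_def internal_op2_def)

lemma stack_psh [simp]: "is_term \<xi> \<Longrightarrow> is_stack \<pi> \<Longrightarrow> is_stack (psh \<xi> \<pi>)"
  using realizability_algebra by (auto simp: realizability_algebra_def internal_op2_def psh_def)

lemma term_kont [simp]: "is_stack \<pi> \<Longrightarrow> is_term (kont \<A> \<pi>)"
  using realizability_algebra by (auto simp: realizability_algebra_def internal_op1_def)

lemma term_prooflike [simp]: "prooflike \<xi> \<Longrightarrow> is_term \<xi>"
  using realizability_algebra by (auto simp: realizability_algebra_def subset_def)

lemma prooflike_combinators [simp]: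
  "prooflike (cB \<A>)" "prooflike (cC \<A>)" "prooflike (cI \<A>)"
  "prooflike (cK \<A>)" "prooflike (cW \<A>)" "prooflike (callcc \<A>)"
  using realizability_algebra by (auto simp: realizability_algebra_def)

lemma prooflike_ap [simp]: "prooflike \<xi> \<Longrightarrow> prooflike \<eta> \<Longrightarrow> prooflike (ap \<A> \<xi> \<eta>)"
  using realizability_algebra by (auto simp: realizability_algebra_def)

lemma dterm_psh [dfn]: "dterm E s \<Longrightarrow> dterm E t \<Longrightarrow> dterm E (\<lambda>e. psh (s e) (t e))"
proof (rule dterm_fun2[where f = psh])
  have "internal_op2 E (Terms \<A>) (Stacks \<A>) (Stacks \<A>) (push \<A>)"
    using realizability_algebra by (auto simp: realizability_algebra_def)
  note op = definable_op2[OF this]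
  have "definable E (\<lambda>e. is_term (e 1) \<and> is_stack (e 2) \<and> e 0 = push \<A> (e 1) (e 2) \<or>
    \<not> (is_term (e 1) \<and> is_stack (e 2)) \<and> e 0 = empty E)"
    by (rule definable_disj[OF op]) (intro dfn)
  then show "definable E (\<lambda>e. e 0 = psh (e 1) (e 2))"
    by (rule definable_cong) (auto simp: psh_def)
qed

lemma definable_star [dfn]: "dterm E s \<Longrightarrow> dterm E t \<Longrightarrow> definable E (\<lambda>e. star (s e) (t e))"
proof (rule definable_subst2[where R = star])
  have "internal_op2 E (Terms \<A>) (Stacks \<A>) (Procs \<A>) (proc \<A>)"
    using realizability_algebra by (auto simp: realizability_algebra_def)
  then have *: "definable E (\<lambda>e. is_term (e 1) \<and> is_stack (e 2) \<and> e 0 = proc \<A> (e 1) (e 2))"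
    by (rule definable_op2)
  have "definable E (\<lambda>e. \<exists>p. E p (Pole \<A>) \<and> is_term (e 0) \<and> is_stack (e 1) \<and> p = proc \<A> (e 0) (e 1))"
    by (intro dfn definable_subst3[where
          R = "\<lambda>p x y. is_term x \<and> is_stack y \<and> p = proc \<A> x y", OF *])
  then show "definable E (\<lambda>e. star (e 0) (e 1))"
    by (rule definable_cong) (auto simp: star_def)
qed

lemma star_step:
  assumes "step E \<A> p q" "E q (Pole \<A>)"
  shows "E p (Pole \<A>)"
  using realizability_algebra assms unfolding realizability_algebra_def
  by (meson r_into_rtranclp)

section \<open>Execution of the combinators\<close>

lemma star_ap: "is_term \<xi> \<Longrightarrow> is_term \<eta> \<Longrightarrow> is_stack \<pi> \<Longrightarrow> star \<xi> (psh \<eta> \<pi>) \<Longrightarrow> star (ap \<A> \<xi> \<eta>) \<pi>"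
  unfolding star_def using star_step[OF step.intros(1)] by (auto simp: psh_def)

lemma star_I: "is_term \<xi> \<Longrightarrow> is_stack \<pi> \<Longrightarrow> star \<xi> \<pi> \<Longrightarrow> star (cI \<A>) (psh \<xi> \<pi>)"
  unfolding star_def using star_step[OF step.intros(2)] stack_psh[of \<xi> \<pi>] by (auto simp: psh_def)

lemma star_K: "is_term \<xi> \<Longrightarrow> is_term \<eta> \<Longrightarrow> is_stack \<pi> \<Longrightarrow> star \<xi> \<pi> \<Longrightarrow>
    star (cK \<A>) (psh \<xi> (psh \<eta> \<pi>))"
  unfolding star_def using star_step[OF step.intros(3)] stack_psh by (auto simp: psh_def)

lemma star_W: "is_term \<xi> \<Longrightarrow> is_term \<eta> \<Longrightarrow> is_stack \<pi> \<Longrightarrow> star \<xi> (psh \<eta> (psh \<eta> \<pi>)) \<Longrightarrow>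
    star (cW \<A>) (psh \<xi> (psh \<eta> \<pi>))"
  unfolding star_def using star_step[OF step.intros(5)] stack_psh by (auto simp: psh_def)

lemma star_C: "is_term \<xi> \<Longrightarrow> is_term \<eta> \<Longrightarrow> is_term \<zeta> \<Longrightarrow> is_stack \<pi> \<Longrightarrow>
    star \<xi> (psh \<zeta> (psh \<eta> \<pi>)) \<Longrightarrow> star (cC \<A>) (psh \<xi> (psh \<eta> (psh \<zeta> \<pi>)))"
  unfolding star_def using star_step[OF step.intros(6)] stack_psh by (auto simp: psh_def)

text \<open>Two execution steps at once: \<open>cB\<close> produces an application, whose argument
  is then pushed.\<close>

lemma star_B: "is_term \<xi> \<Longrightarrow> is_term \<eta> \<Longrightarrow> is_term \<zeta> \<Longrightarrow> is_stack \<pi> \<Longrightarrow>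
    star \<xi> (psh (ap \<A> \<eta> \<zeta>) \<pi>) \<Longrightarrow> star (cB \<A>) (psh \<xi> (psh \<eta> (psh \<zeta> \<pi>)))"
  unfolding star_def
  using star_step[OF step.intros(7)] star_step[OF step.intros(1)] stack_psh by (auto simp: psh_def)

lemma star_callcc: "is_term \<xi> \<Longrightarrow> is_stack \<pi> \<Longrightarrow> star \<xi> (psh (kont \<A> \<pi>) \<pi>) \<Longrightarrow>
    star (callcc \<A>) (psh \<xi> \<pi>)"
  unfolding star_def using star_step[OF step.intros(8)] stack_psh by (auto simp: psh_def)

lemma star_kont: "is_term \<xi> \<Longrightarrow> is_stack \<pi> \<Longrightarrow> is_stack \<rho> \<Longrightarrow> star \<xi> \<pi> \<Longrightarrow>
    star (kont \<A> \<pi>) (psh \<xi> \<rho>)"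
  unfolding star_def using star_step[OF step.intros(9)] stack_psh by (auto simp: psh_def)

lemmas star_intros = star_ap star_I star_K star_W star_C star_B star_callcc star_kont

section \<open>Falsity values and their realizers\<close>

definition rz :: "'v set \<Rightarrow> 'v set" where
  "rz P = {\<xi>. is_term \<xi> \<and> (\<forall>\<pi>\<in>P. is_stack \<pi> \<longrightarrow> star \<xi> \<pi>)}"

text \<open>Here and in \<open>rz\<close> everything but terms and stacks is discarded, so that
  arbitrary sets of individuals may serve as types and falsity values.\<close>

definition arr :: "'v set \<Rightarrow> 'v set \<Rightarrow> 'v set" where
  "arr T P = {psh \<xi> \<pi> |\<xi> \<pi>. \<xi> \<in> T \<and> is_term \<xi> \<and> \<pi> \<in> P \<and> is_stack \<pi>}"

definition falsity :: "'v set" where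
  "falsity = {\<pi>. is_stack \<pi>}"

lemma rz_term: "\<xi> \<in> rz P \<Longrightarrow> is_term \<xi>"
  by (simp add: rz_def)

lemma rzD: "\<xi> \<in> rz P \<Longrightarrow> \<pi> \<in> P \<Longrightarrow> is_stack \<pi> \<Longrightarrow> star \<xi> \<pi>"
  by (simp add: rz_def)

lemma rz_antimono: "P \<inter> falsity \<subseteq> Q \<Longrightarrow> rz Q \<subseteq> rz P"
  by (auto simp: rz_def falsity_def)

lemma rz_UN: "\<xi> \<in> rz (\<Union>j\<in>J. P j) \<longleftrightarrow> is_term \<xi> \<and> (\<forall>j\<in>J. \<xi> \<in> rz (P j))"
  by (auto simp: rz_def)

lemma rz_arr: "\<xi> \<in> rz (arr T P) \<longleftrightarrow>
    is_term \<xi> \<and> (\<forall>\<eta>\<in>T. is_term \<eta> \<longrightarrow> (\<forall>\<pi>\<in>P. is_stack \<pi> \<longrightarrow> star \<xi> (psh \<eta> \<pi>)))"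
  by (force simp: rz_def arr_def)

lemma ball_arr: "(\<forall>\<pi>\<in>arr T P. is_stack \<pi> \<longrightarrow> Q \<pi>) \<longleftrightarrow>
    (\<forall>\<eta>\<in>T. is_term \<eta> \<longrightarrow> (\<forall>\<pi>\<in>P. is_stack \<pi> \<longrightarrow> Q (psh \<eta> \<pi>)))"
  by (force simp: arr_def)

lemma rz_arrD: "\<xi> \<in> rz (arr (rz Q) P) \<Longrightarrow> \<eta> \<in> rz Q \<Longrightarrow> ap \<A> \<xi> \<eta> \<in> rz P"
  unfolding rz_arr by (auto simp: rz_def intro!: star_ap)

lemma arr_mono: "T \<subseteq> S \<Longrightarrow> P \<inter> falsity \<subseteq> Q \<Longrightarrow> arr T P \<subseteq> arr S Q"
  by (auto simp: arr_def falsity_def)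

lemma arr_subset_falsity: "arr T P \<subseteq> falsity"
  by (auto simp: arr_def falsity_def)

text \<open>A sequent is a family, indexed by i, of contexts (types given as sets of terms, the most
  recent hypothesis first) and conclusions (falsity values); \<open>ent\<close> says that one proof-like term
  realizes all its instances with i in I.\<close>

primrec ctx :: "('i \<Rightarrow> 'v set) list \<Rightarrow> ('i \<Rightarrow> 'v set) \<Rightarrow> 'i \<Rightarrow> 'v set" where
  "ctx [] P = P"
| "ctx (T # G) P = ctx G (\<lambda>i. arr (T i) (P i))"

definition ent :: "'i set \<Rightarrow> ('i \<Rightarrow> 'v set) list \<Rightarrow> ('i \<Rightarrow> 'v set) \<Rightarrow> bool" where
  "ent I G P \<longleftrightarrow> (\<exists>\<theta>. prooflike \<theta> \<and> (\<forall>i\<in>I. \<theta> \<in> rz (ctx G P i)))"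

section \<open>A sequent calculus with uniform realizers\<close>

lemma ctx_mono:
  "list_all2 (\<lambda>T S. T i \<subseteq> S j) G H \<Longrightarrow> P i \<inter> falsity \<subseteq> Q j \<Longrightarrow> ctx G P i \<inter> falsity \<subseteq> ctx H Q j"
proof (induction G H arbitrary: P Q rule: list_all2_induct)
  case (Cons T G S H)
  have "arr (T i) (P i) \<inter> falsity \<subseteq> arr (S j) (Q j)"
    using arr_mono[OF Cons.hyps(1) Cons.prems] by blast
  with Cons.IH show ?case by simp
qed simp

text \<open>A stack of a sequent is a stack of the conclusion with terms for the hypotheses pushed
  onto it; isolating the bottom \<pi> allows \<open>ent_reindex\<close> to depend on it.\<close>

lemma ctx_singleton: "\<sigma> \<in> ctx G P i \<Longrightarrow> \<sigma> \<in> falsity \<Longrightarrow> \<exists>\<pi>\<in>P i. \<pi> \<in> falsity \<and> \<sigma> \<in> ctx G (\<lambda>_. {\<pi>}) i"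
proof (induction G arbitrary: P)
  case (Cons T G)
  then obtain \<rho> where \<rho>: "\<rho> \<in> arr (T i) (P i)" "\<rho> \<in> falsity" "\<sigma> \<in> ctx G (\<lambda>_. {\<rho>}) i" by fastforce
  then obtain \<xi> \<pi> where \<pi>: "\<rho> = psh \<xi> \<pi>" "\<xi> \<in> T i" "is_term \<xi>" "\<pi> \<in> P i" "is_stack \<pi>"
    by (auto simp: arr_def)
  have "ctx G (\<lambda>_. {\<rho>}) i \<inter> falsity \<subseteq> ctx (T # G) (\<lambda>_. {\<pi>}) i"
    unfolding ctx.simps
    by (rule ctx_mono) (use \<pi> in \<open>auto simp: arr_def list_all2_same\<close>)
  then show ?case using \<rho> \<pi> Cons.prems by (auto simp: falsity_def)
qed auto

text \<open>Realizing a family means being orthogonal to every stack of every member, so j may be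
  chosen after \<pi>. Universal quantifiers are thus handled without changing the realizer.\<close>

lemma ent_reindex:
  assumes "ent J H Q"
    and "\<And>i \<pi>. i \<in> I \<Longrightarrow> \<pi> \<in> P i \<Longrightarrow> is_stack \<pi> \<Longrightarrow>
      \<exists>j\<in>J. \<pi> \<in> Q j \<and> list_all2 (\<lambda>T S. T i \<subseteq> S j) G H"
  shows "ent I G P"
proof -
  obtain \<theta> where \<theta>: "prooflike \<theta>" "\<And>j. j \<in> J \<Longrightarrow> \<theta> \<in> rz (ctx H Q j)"
    using assms(1) unfolding ent_def by blast
  have "star \<theta> \<sigma>" if i: "i \<in> I" and \<sigma>: "\<sigma> \<in> ctx G P i" "is_stack \<sigma>" for i \<sigma>
  proof -
    obtain \<pi> where \<pi>: "\<pi> \<in> P i" "is_stack \<pi>" "\<sigma> \<in> ctx G (\<lambda>_. {\<pi>}) i"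
      using ctx_singleton[OF \<sigma>(1)] \<sigma>(2) by (auto simp: falsity_def)
    obtain j where j: "j \<in> J" "\<pi> \<in> Q j" "list_all2 (\<lambda>T S. T i \<subseteq> S j) G H"
      using assms(2)[OF i \<pi>(1,2)] by blast
    have "\<sigma> \<in> ctx H Q j"
      using ctx_mono[OF j(3), of "\<lambda>_. {\<pi>}" Q] j(2) \<pi>(3) \<sigma>(2) by (auto simp: falsity_def)
    then show ?thesis using rzD[OF \<theta>(2)[OF j(1)]] \<sigma>(2) by blast
  qed
  then show ?thesis unfolding ent_def using \<theta>(1) by (auto simp: rz_def)
qed

lemma ent_sub:
  assumes "ent I G Q" "\<And>i. i \<in> I \<Longrightarrow> P i \<inter> falsity \<subseteq> Q i"
  shows "ent I G P"
  by (rule ent_reindex[OF assms(1)]) (use assms(2) in \<open>force simp: falsity_def list_all2_same\<close>)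

lemma ent_closed: "prooflike \<theta> \<Longrightarrow> (\<And>i. i \<in> I \<Longrightarrow> \<theta> \<in> rz (P i)) \<Longrightarrow> ent I [] P"
  by (auto simp: ent_def)

lemma ent_impI: "ent I (T # G) P \<Longrightarrow> ent I G (\<lambda>i. arr (T i) (P i))"
  by (simp add: ent_def)

lemma ent_impE: "ent I G (\<lambda>i. arr (T i) (P i)) \<Longrightarrow> ent I (T # G) P"
  by (simp add: ent_def)

lemma ent_lift:
  assumes "ent I [] P" shows "ent I G P"
  using assms
proof (induction G arbitrary: P)
  case (Cons T G)
  obtain \<theta> where \<theta>: "prooflike \<theta>" "\<And>i. i \<in> I \<Longrightarrow> \<theta> \<in> rz (P i)"
    using Cons.prems unfolding ent_def by auto
  have "ent I [] (\<lambda>i. arr (T i) (P i))"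
  proof (rule ent_closed[of "ap \<A> (cK \<A>) \<theta>"])
    fix i assume "i \<in> I"
    from rzD[OF \<theta>(2)[OF this]] show "ap \<A> (cK \<A>) \<theta> \<in> rz (arr (T i) (P i))"
      using \<theta>(1) by (auto simp: rz_arr intro!: star_intros)
  qed (use \<theta> in simp)
  from Cons.IH[OF this] show ?case by (rule ent_impE)
qed simp

text \<open>Induction on the context by bracket abstraction: each hypothesis costs one combinator
  \<open>S\<close>.\<close>

lemma ent_mp:
  assumes "ent I G (\<lambda>i. arr (rz (Q i)) (P i))" "ent I G Q"
  shows "ent I G P"
  using assms
proof (induction G arbitrary: P Q)
  case Nil
  then obtain \<xi> \<eta> where "prooflike \<xi>" "prooflike \<eta>"
    "\<And>i. i \<in> I \<Longrightarrow> \<xi> \<in> rz (arr (rz (Q i)) (P i))" "\<And>i. i \<in> I \<Longrightarrow> \<eta> \<in> rz (Q i)"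
    unfolding ent_def by auto
  then show ?case by (auto intro!: ent_closed[of "ap \<A> \<xi> \<eta>"] rz_arrD)
next
  case (Cons T G)
  define QP' where "QP' = (\<lambda>i. arr (T i) (arr (rz (Q i)) (P i)))"
  define Q' where "Q' = (\<lambda>i. arr (T i) (Q i))"
  \<comment> \<open>The usual S, which sends \<xi>, \<eta>, \<zeta> to \<xi> applied to \<zeta> and
    to \<eta>\<zeta>, composed from B, C and W.\<close>
  define S where "S = ap \<A> (ap \<A> (cB \<A>) (ap \<A> (ap \<A> (cB \<A>) (ap \<A> (cB \<A>) (cW \<A>))) (cC \<A>)))
    (ap \<A> (cB \<A>) (cB \<A>))"
  have S: "star S (psh \<xi> (psh \<eta> (psh \<zeta> \<pi>)))"
    if "is_term \<xi>" "is_term \<eta>" "is_term \<zeta>" "is_stack \<pi>" "star \<xi> (psh \<zeta> (psh (ap \<A> \<eta> \<zeta>) \<pi>))"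
    for \<xi> \<eta> \<zeta> \<pi>
    unfolding S_def by (intro star_intros) (use that in simp_all)
  have "ent I [] (\<lambda>i. arr (rz (QP' i)) (arr (rz (Q' i)) (arr (T i) (P i))))"
  proof (rule ent_closed[of S])
    show "prooflike S" by (simp add: S_def)
    fix i assume "i \<in> I"
    have "star \<xi> (psh \<zeta> (psh (ap \<A> \<eta> \<zeta>) \<pi>))"
      if "\<xi> \<in> rz (QP' i)" "\<eta> \<in> rz (Q' i)" "\<zeta> \<in> T i" "is_term \<zeta>" "\<pi> \<in> P i" "is_stack \<pi>" for \<xi> \<eta> \<zeta> \<pi>
    proof -
      have "ap \<A> \<eta> \<zeta> \<in> rz (Q i)"
        using that(2-4) unfolding Q'_def rz_arr by (auto simp: rz_def intro!: star_ap)
      then have "psh (ap \<A> \<eta> \<zeta>) \<pi> \<in> arr (rz (Q i)) (P i)" "is_stack (psh (ap \<A> \<eta> \<zeta>) \<pi>)"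
        using that(5,6) rz_term[of "ap \<A> \<eta> \<zeta>" "Q i"] by (auto simp: arr_def)
      then show ?thesis using that(1,3,4) unfolding QP'_def rz_arr by blast
    qed
    moreover have "is_term S" using \<open>prooflike S\<close> by simp
    ultimately show "S \<in> rz (arr (rz (QP' i)) (arr (rz (Q' i)) (arr (T i) (P i))))"
      by (force simp: rz_def arr_def intro!: S)
  qed
  then have *: "ent I G (\<lambda>i. arr (rz (QP' i)) (arr (rz (Q' i)) (arr (T i) (P i))))"
    by (rule ent_lift)
  have **: "ent I G QP'" "ent I G Q'"
    using Cons.prems unfolding QP'_def Q'_def by (auto intro: ent_impI)
  have "ent I G (\<lambda>i. arr (T i) (P i))"
    by (rule Cons.IH[OF Cons.IH[OF * **(1)] **(2)])
  then show ?case by (rule ent_impE)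
qed

lemma ent_weak:
  assumes "ent I G P" shows "ent I (T # G) P"
proof -
  have "ent I [] (\<lambda>i. arr (rz (P i)) (arr (T i) (P i)))"
    by (rule ent_closed[of "cK \<A>"])
      (auto simp: rz_def arr_def intro!: star_intros)
  from ent_mp[OF ent_lift[OF this] assms] show ?thesis by (rule ent_impE)
qed

lemma ent_assm:
  assumes "n < length G" "\<And>i. i \<in> I \<Longrightarrow> (G ! n) i \<subseteq> rz (P i)"
  shows "ent I G P"
  using assms
proof (induction G arbitrary: n)
  case (Cons T G)
  show ?case
  proof (cases n)
    case 0
    have "ent I [] (\<lambda>i. arr (T i) (P i))"
    proof (rule ent_closed[of "cI \<A>"])
      fix i assume "i \<in> I"
      then have "T i \<subseteq> rz (P i)" using Cons.prems(2) 0 by simp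
      then show "cI \<A> \<in> rz (arr (T i) (P i))"
        by (auto simp: rz_arr rzD intro!: star_I)
    qed simp
    from ent_lift[OF this] show ?thesis by (rule ent_impE)
  next
    case (Suc m)
    with Cons show ?thesis by (auto intro!: ent_weak)
  qed
qed simp

text \<open>\<open>callcc\<close> saves a stack \<pi> of the conclusion, and the continuation
  \<open>kont\<close> of \<pi> realizes the negated conclusion.\<close>

lemma ent_callcc:
  assumes "ent I ((\<lambda>i. rz (arr (rz (P i)) falsity)) # G) (\<lambda>_. falsity)"
  shows "ent I G P"
proof -
  define N where "N = (\<lambda>i. rz (arr (rz (P i)) falsity))"
  have "ent I [] (\<lambda>i. arr (rz (arr (N i) (P i))) (P i))"
  proof (rule ent_closed[of "callcc \<A>"])
    fix i
    have "kont \<A> \<pi> \<in> N i" if "\<pi> \<in> P i" "is_stack \<pi>" for \<pi>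
      using that unfolding N_def rz_arr by (auto simp: falsity_def rz_term rzD intro!: star_kont)
    then show "callcc \<A> \<in> rz (arr (rz (arr (N i) (P i))) (P i))"
      by (auto simp: rz_arr intro!: star_callcc)
  qed simp
  moreover have "ent I (N # G) P"
    by (rule ent_sub[OF assms[folded N_def]]) simp
  ultimately show ?thesis
    using ent_mp[OF ent_lift ent_impI] by blast
qed

text \<open>The realizer is the fixed point Y of the realizer of the induction step, as in
  \<open>Y = (WI)(B\<theta>(WI))\<close>.\<close>

lemma ent_induct:
  assumes definable: "\<And>i \<theta>. i \<in> I \<Longrightarrow> is_term \<theta> \<Longrightarrow> definable E (\<lambda>e. \<theta> \<in> rz (P i (e 0)))"
    and step: "ent (I \<times> UNIV) []
      (\<lambda>p. arr (rz (\<Union>y\<in>{y. below E y (snd p)}. P (fst p) y)) (P (fst p) (snd p)))"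
  shows "ent (I \<times> UNIV) [] (\<lambda>p. P (fst p) (snd p))"
proof -
  obtain \<theta> where \<theta>: "prooflike \<theta>"
    and step: "\<And>i x. i \<in> I \<Longrightarrow> \<theta> \<in> rz (arr (rz (\<Union>y\<in>{y. below E y x}. P i y)) (P i x))"
    using step unfolding ent_def by auto
  define D where "D = ap \<A> (ap \<A> (cB \<A>) \<theta>) (ap \<A> (cW \<A>) (cI \<A>))"
  define Y where "Y = ap \<A> (ap \<A> (cW \<A>) (cI \<A>)) D"
  have Y: "prooflike Y" unfolding Y_def D_def using \<theta> by simp
  have D: "is_term D" unfolding D_def using \<theta> by simp
  have "star D (psh D \<pi>)" if "is_stack \<pi>" "star \<theta> (psh Y \<pi>)" for \<pi>
    by (subst (1) D_def) (intro star_intros, use \<theta> that D in \<open>simp_all add: Y_def\<close>)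
  then have star_Y: "star Y \<pi>" if "is_stack \<pi>" "star \<theta> (psh Y \<pi>)" for \<pi>
    by (subst Y_def) (intro star_ap star_W star_I, use that D in simp_all)
  have "Y \<in> rz (P i x)" if i: "i \<in> I" for i x
  \<comment> \<open>The induction takes place inside the ground model, which may be ill-founded from
    outside; hence the definability hypothesis.\<close>
  proof (rule below_induct[where P = "\<lambda>x. Y \<in> rz (P i x)"])
    show "definable E (\<lambda>e. Y \<in> rz (P i (e 0)))" using definable[OF i] Y by simp
    fix x assume "\<And>y. below E y x \<Longrightarrow> Y \<in> rz (P i y)"
    then have "Y \<in> rz (\<Union>y\<in>{y. below E y x}. P i y)" using Y by (auto simp: rz_def)
    then have "star \<theta> (psh Y \<pi>)" if "\<pi> \<in> P i x" "is_stack \<pi>" for \<pi>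
      using step[OF i, of x] that Y unfolding rz_arr by simp
    then show "Y \<in> rz (P i x)" using Y star_Y by (simp add: rz_def)
  qed
  then show ?thesis using Y unfolding ent_def by auto
qed

text \<open>Introduction of a universal quantifier: the eigenvariable k joins the index and the
  context ignores it.\<close>

lemma ent_UN:
  assumes "ent (Sigma I K) (map (\<lambda>T p. T (fst p)) G) (\<lambda>p. P (fst p) (snd p))"
  shows "ent I G (\<lambda>i. \<Union>k\<in>K i. P i k)"
  by (rule ent_reindex[OF assms]) (force simp: list_all2_map2 list_all2_same)

lemma ent_app:
  assumes "n < length G" "\<And>i. i \<in> I \<Longrightarrow> (G ! n) i \<subseteq> rz (arr (rz (Q i)) (P i))" "ent I G Q"
  shows "ent I G P"
  by (rule ent_mp[OF ent_assm[OF assms(1)] assms(3)]) (use assms(2) in blast)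

lemma ent_app_assm:
  assumes "ent I G (\<lambda>i. arr (rz (Q i)) (P i))" "n < length G" "\<And>i. i \<in> I \<Longrightarrow> (G ! n) i \<subseteq> rz (Q i)"
  shows "ent I G P"
  by (rule ent_mp[OF assms(1) ent_assm[OF assms(2)]]) (use assms(3) in blast)

definition neg :: "'v set \<Rightarrow> 'v set" where
  "neg P = arr (rz P) falsity"

lemma ent_contradiction:
  assumes "ent I ((\<lambda>i. rz (neg (P i))) # G) (\<lambda>_. falsity)"
  shows "ent I G P"
  by (rule ent_callcc) (use assms in \<open>simp add: neg_def\<close>)

section \<open>The truth values of \<open>\<D>\<close>\<close>

text \<open>The condition \<langle>y<x\<rangle> \<ge> b for b in {0,1}, which always holds for b =
  0.\<close>

definition guard :: "bool \<Rightarrow> 'v \<Rightarrow> 'v \<Rightarrow> bool" where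
  "guard b y x \<longleftrightarrow> (b \<longrightarrow> below E y x)"

definition nE :: "'v \<Rightarrow> 'v \<Rightarrow> 'v set" where
  "nE x X = {\<pi>. is_stack \<pi> \<and> E (pair E x \<pi>) X}"

definition prog :: "bool \<Rightarrow> 'v \<Rightarrow> 'v set" where
  "prog b X = (\<Union>x. arr (rz (\<Union>y\<in>{y. guard b y x}. nE y X)) (nE x X))"

text \<open>The truth value of \<D>[\<alpha>] for \<alpha> of value b, see
  \<open>truth_value_DD\<close>; \<open>prog\<close> stands for its hypothesis, that the complement
  of X is progressive.\<close>

definition DV :: "bool \<Rightarrow> 'v set" where
  "DV b = (\<Union>X. arr (rz (prog b X)) (\<Union>x. nE x X))"

text \<open>The guard of c admits fewer y and stands to the left of two arrows, so every realizer of
  \<D>[b] realizes \<D>[c].\<close>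

lemma DV_antimono:
  assumes "b \<longrightarrow> c" shows "DV c \<subseteq> DV b"
proof -
  have "prog b X \<subseteq> prog c X" for X
    unfolding prog_def using assms by (intro UN_mono arr_mono rz_antimono) (auto simp: guard_def)
  then show ?thesis
    unfolding DV_def by (intro UN_mono arr_mono rz_antimono) auto
qed

text \<open>X must be a set, so it is prescribed on a set T; outside T the falsity value is empty
  and progressivity is trivial.\<close>

lemma ex_nE:
  assumes "definable E (\<lambda>e. R (e 0) (e 1))"
  shows "\<exists>X. \<forall>x. nE x X = (if E x T then {\<pi>. is_stack \<pi> \<and> R x \<pi>} else {})"
  using relation_set[OF assms, of T "Stacks \<A>"] by (auto simp: nE_def)

lemma DV_False_realizer: "ap \<A> (ap \<A> (cC \<A>) (cI \<A>)) (cI \<A>) \<in> rz (neg (DV False))"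
proof -
  \<comment> \<open>X has the empty set as its only point, with every stack. The guard of 0 makes
    this point its own predecessor, so \<open>cI\<close> realizes progressivity.\<close>
  obtain X where X: "\<And>x. nE x X = (if E x (one E) then {\<pi>. is_stack \<pi> \<and> True} else {})"
    using ex_nE[OF definable_const] by blast
  have "E (empty E) (one E)" by (simp add: one_def)
  then have nX: "nE (empty E) X = falsity" by (simp add: X falsity_def)
  have "rz (\<Union>y\<in>{y. guard False y x}. nE y X) \<subseteq> rz falsity" for x
    by (rule rz_antimono) (use nX in \<open>auto simp: guard_def\<close>)
  then have "star \<xi> \<pi>" if "\<xi> \<in> rz (\<Union>y\<in>{y. guard False y x}. nE y X)" "is_stack \<pi>" for \<xi> \<pi> x
    using that rzD[of \<xi> falsity \<pi>] by (auto simp: falsity_def)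
  then have "cI \<A> \<in> rz (prog False X)"
    by (auto simp: prog_def rz_UN[of "cI \<A>"] rz_arr intro!: star_I)
  then have "psh (cI \<A>) \<pi> \<in> DV False" if "is_stack \<pi>" for \<pi>
    unfolding DV_def arr_def using that nX by (fastforce simp: falsity_def)
  then show ?thesis
    by (auto simp: rz_arr neg_def falsity_def rz_term rzD intro!: star_ap star_C star_I)
qed

lemma definable_rz_nE [dfn]:
  "dterm E s \<Longrightarrow> dterm E t \<Longrightarrow> dterm E u \<Longrightarrow> definable E (\<lambda>e. s e \<in> rz (nE (t e) (u e)))"
proof (rule definable_subst3[where R = "\<lambda>\<xi> x X. \<xi> \<in> rz (nE x X)"])
  have "definable E (\<lambda>e. is_term (e 0) \<and>
      (\<forall>\<pi>. is_stack \<pi> \<and> E (pair E (e 1) \<pi>) (e 2) \<longrightarrow> star (e 0) \<pi>))"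
    by (intro dfn)
  then show "definable E (\<lambda>e. e 0 \<in> rz (nE (e 1) (e 2)))"
    by (rule definable_cong) (auto simp: rz_def nE_def)
qed

lemma definable_rz_neg_nE [dfn]:
  "dterm E s \<Longrightarrow> dterm E t \<Longrightarrow> dterm E u \<Longrightarrow> definable E (\<lambda>e. s e \<in> rz (neg (nE (t e) (u e))))"
proof (rule definable_subst3[where R = "\<lambda>\<xi> x X. \<xi> \<in> rz (neg (nE x X))"])
  have "definable E (\<lambda>e. is_term (e 0) \<and>
      (\<forall>\<eta>. is_term \<eta> \<and> \<eta> \<in> rz (nE (e 1) (e 2)) \<longrightarrow> (\<forall>\<pi>. is_stack \<pi> \<longrightarrow> star (e 0) (psh \<eta> \<pi>))))"
    by (intro dfn)
  then show "definable E (\<lambda>e. e 0 \<in> rz (neg (nE (e 1) (e 2))))"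
    by (rule definable_cong) (auto simp: rz_arr neg_def falsity_def)
qed

lemma definable_guard [dfn]:
  "dterm E s \<Longrightarrow> dterm E t \<Longrightarrow> definable E (\<lambda>e. guard b (s e) (t e))"
  unfolding guard_def by (intro dfn)

lemma definable_rz_prog [dfn]:
  "dterm E s \<Longrightarrow> dterm E t \<Longrightarrow> definable E (\<lambda>e. s e \<in> rz (prog b (t e)))"
proof (rule definable_subst2[where R = "\<lambda>\<xi> X. \<xi> \<in> rz (prog b X)"])
  have "definable E (\<lambda>e. is_term (e 0) \<and>
      (\<forall>x \<eta> \<pi>. is_term \<eta> \<and> is_stack \<pi> \<and> E (pair E x \<pi>) (e 1) \<and>
         (\<forall>y. guard b y x \<longrightarrow> \<eta> \<in> rz (nE y (e 1))) \<longrightarrow> star (e 0) (psh \<eta> \<pi>)))"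
    by (intro dfn)
  then show "definable E (\<lambda>e. e 0 \<in> rz (prog b (e 1)))"
    by (rule definable_cong) (fastforce simp: rz_def prog_def arr_def nE_def)
qed

section \<open>Excluded middle for \<open>\<D>\<close>\<close>

text \<open>If X has no minimal element for the guard b, and X' none for its negation, then merging
  the coordinates x and x' (here: the one that the guard sees) gives an infinite descent.\<close>

definition descent :: "bool \<Rightarrow> 'v \<Rightarrow> 'v \<Rightarrow> 'v \<Rightarrow> 'v \<Rightarrow> 'v set" where
  "descent b X X' x x' = arr (rz (prog b X)) (arr (rz (prog (\<not> b) X'))
     (arr (rz (neg (nE x X))) (arr (rz (neg (nE x' X'))) falsity)))"

lemma definable_rz_descent [dfn]:
  "dterm E s \<Longrightarrow> dterm E t \<Longrightarrow> definable E (\<lambda>e. \<theta> \<in> rz (descent b X X' (s e) (t e)))"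
proof (rule definable_subst2[where R = "\<lambda>x x'. \<theta> \<in> rz (descent b X X' x x')"])
  have "definable E (\<lambda>e. is_term \<theta> \<and>
      (\<forall>f f' j j' \<pi>. f \<in> rz (prog b X) \<and> f' \<in> rz (prog (\<not> b) X') \<and>
         j \<in> rz (neg (nE (e 0) X)) \<and> j' \<in> rz (neg (nE (e 1) X')) \<and> is_stack \<pi> \<longrightarrow>
         star \<theta> (psh f (psh f' (psh j (psh j' \<pi>))))))"
    by (intro dfn)
  then show "definable E (\<lambda>e. \<theta> \<in> rz (descent b X X' (e 0) (e 1)))"
  proof (rule definable_cong)
    fix e :: "nat \<Rightarrow> 'v"
    show "(is_term \<theta> \<and>
      (\<forall>f f' j j' \<pi>. f \<in> rz (prog b X) \<and> f' \<in> rz (prog (\<not> b) X') \<and>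
         j \<in> rz (neg (nE (e 0) X)) \<and> j' \<in> rz (neg (nE (e 1) X')) \<and> is_stack \<pi> \<longrightarrow>
         star \<theta> (psh f (psh f' (psh j (psh j' \<pi>)))))) \<longleftrightarrow> \<theta> \<in> rz (descent b X X' (e 0) (e 1))"
      by (simp add: descent_def rz_arr ball_arr falsity_def) (meson rz_term)
  qed
qed

text \<open>The induction runs along the coordinate z that the guard sees, as only this one is sure
  to descend; the other is quantified inside \<open>P\<close>.\<close>

lemma descent_realized: "ent J [] (\<lambda>j. descent (c j) (Y j) (Y' j) (y j) (y' j))"
proof -
  define P where "P = (\<lambda>(b :: bool, X, X') z.
    \<Union>q\<in>{q. (if b then fst q else snd q) = z}. descent b X X' (fst q) (snd q))"
  have "ent (UNIV \<times> UNIV) [] (\<lambda>p. P (fst p) (snd p))"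
  proof (rule ent_induct)
    fix i :: "bool \<times> 'v \<times> 'v" and \<theta> assume \<theta>: "is_term \<theta>"
    obtain b X X' where i: "i = (b, X, X')" using prod_cases3 by blast
    have "definable E (\<lambda>e. is_term \<theta> \<and> (\<forall>x x'. (if b then x = e 0 else x' = e 0) \<longrightarrow> \<theta> \<in> rz (descent b X X' x x')))"
      by (intro dfn)
    then show "definable E (\<lambda>e. \<theta> \<in> rz (P i (e 0)))"
      by (rule definable_cong) (auto simp: P_def i rz_def)
  next
    define R where "R b X X' x x' = rz (\<Union>z\<in>{z. below E z (if b then x else x')}. P (b, X, X') z)"
      for b X X' x x'
    \<comment> \<open>Exactly one of the two guards is a genuine order condition, and it moves the
      selected coordinate down.\<close>
    have R: "R b X X' x x' \<subseteq> rz (descent b X X' y y')" if "guard b y x" "guard (\<not> b) y' x'"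
      for b X X' x x' y y'
      unfolding R_def by (rule rz_antimono) (use that in \<open>force simp: P_def guard_def\<close>)
    have prog: "rz (prog b X) \<subseteq> rz (arr (rz (\<Union>y\<in>{y. guard b y x}. nE y X)) (nE x X))" for b X x
      by (rule rz_antimono) (auto simp: prog_def)
    have neg: "rz (neg P) \<subseteq> rz (arr (rz P) falsity)" for P
      by (simp add: neg_def)
    \<comment> \<open>Since x lies in X, progressivity provides some y in X passing the guard, and
      likewise some y' in X'; the induction hypothesis refutes this pair.\<close>
    have step: "ent I [\<lambda>i. rz (neg (nE (x' i) (X' i))), \<lambda>i. rz (neg (nE (x i) (X i))),
        \<lambda>i. rz (prog (\<not> b i) (X' i)), \<lambda>i. rz (prog (b i) (X i)),
        \<lambda>i. R (b i) (X i) (X' i) (x i) (x' i)] (\<lambda>_. falsity)"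
      for I :: "'j set" and b x x' X X'
      apply (rule ent_app[where n = 1 and Q = "\<lambda>i. nE (x i) (X i)"])
        apply (simp_all add: neg)
      apply (rule ent_app[where n = 3 and Q = "\<lambda>i. \<Union>y\<in>{y. guard (b i) y (x i)}. nE y (X i)"])
        apply (simp_all add: prog)
      apply (rule ent_UN, rule ent_contradiction, unfold list.map)
      apply (rule ent_app[where n = 1 and Q = "\<lambda>p. nE (x' (fst p)) (X' (fst p))"])
        apply (simp_all add: neg)
      apply (rule ent_app[where n = 3 and Q = "\<lambda>p. \<Union>y\<in>{y. guard (\<not> b (fst p)) y (x' (fst p))}. nE y (X' (fst p))"])
        apply (simp_all add: prog)
      apply (rule ent_UN, rule ent_contradiction, unfold list.map)
      apply (rule ent_app_assm[where n = 0 and Q = "\<lambda>p. neg (nE (snd p) (X' (fst (fst p))))"])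
        apply (rule ent_app_assm[where n = 1 and Q = "\<lambda>p. neg (nE (snd (fst p)) (X (fst (fst p))))"])
          apply (rule ent_app_assm[where n = 4 and Q = "\<lambda>p. prog (\<not> b (fst (fst p))) (X' (fst (fst p)))"])
            apply (rule ent_app_assm[where n = 5 and Q = "\<lambda>p. prog (b (fst (fst p))) (X (fst (fst p)))"])
              apply (rule ent_assm[where n = 6])
               apply simp
              apply (simp add: descent_def[symmetric])
              apply (rule R; force)
             apply simp_all
      done
    have "ent UNIV [\<lambda>j. R (fst (fst j)) (fst (snd (fst j))) (snd (snd (fst j))) (fst (snd j)) (snd (snd j))]
        (\<lambda>j. descent (fst (fst j)) (fst (snd (fst j))) (snd (snd (fst j))) (fst (snd j)) (snd (snd j)))"
      unfolding descent_def by (rule ent_impI step)+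
    then have "ent (UNIV \<times> UNIV) [\<lambda>p. rz (\<Union>y\<in>{y. below E y (snd p)}. P (fst p) y)] (\<lambda>p. P (fst p) (snd p))"
    proof (rule ent_reindex, goal_cases)
      case (1 p \<pi>)
      obtain b X X' z where p: "p = ((b, X, X'), z)" by (metis prod.collapse)
      obtain x x' where "z = (if b then x else x')" "\<pi> \<in> descent b X X' x x'"
        using 1 by (auto simp: P_def p)
      then show ?case
        by (intro bexI[of _ "((b, X, X'), (x, x'))"]) (auto simp: R_def p)
    qed
    then show "ent (UNIV \<times> UNIV) [] (\<lambda>p. arr (rz (\<Union>y\<in>{y. below E y (snd p)}. P (fst p) y)) (P (fst p) (snd p)))"
      by (rule ent_impI)
  qed
  then show ?thesis
    by (rule ent_reindex) (auto simp: P_def, blast)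
qed

text \<open>A failure of \<D>[\<not>b] provides X' and a point in it, the failure of \<D>[b]
  provides X and a point in it, and \<open>descent_realized\<close> refutes the two
  together.\<close>

lemma excluded_middle: "ent I [\<lambda>i. rz (neg (DV (b i)))] (\<lambda>i. DV (\<not> b i))"
  unfolding DV_def[of "\<not> _"]
  apply (rule ent_UN, rule ent_impI, rule ent_UN, rule ent_contradiction, unfold list.map)
  apply (rule ent_app[where n = 2 and Q = "\<lambda>p. DV (b (fst (fst p)))"])
    apply (simp_all add: neg_def)
  apply (unfold DV_def)
  apply (rule ent_UN, rule ent_impI, rule ent_UN, rule ent_contradiction, unfold list.map)
  apply (rule ent_app_assm[where n = 2 and Q = "\<lambda>p. neg (nE (snd (fst (fst p))) (snd (fst (fst (fst p)))))"])
    apply (rule ent_app_assm[where n = 0 and Q = "\<lambda>p. neg (nE (snd p) (snd (fst p)))"])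
      apply (rule ent_app_assm[where n = 3 and Q = "\<lambda>p. prog (\<not> b (fst (fst (fst (fst p))))) (snd (fst (fst (fst p))))"])
        apply (rule ent_app_assm[where n = 1 and Q = "\<lambda>p. prog (b (fst (fst (fst (fst p))))) (snd (fst p))"])
          apply (rule ent_lift, fold descent_def, rule descent_realized)
         apply (simp_all add: neg_def)
  done

section \<open>The hierarchy K\<close>

text \<open>\<open>orth \<xi> \<eta>\<close> says that \<open>\<xi>\<close> realizes \<open>{\<eta>} \<rightarrow> \<bottom>\<close>.\<close>

definition orth :: "'v \<Rightarrow> 'v \<Rightarrow> bool" where
  "orth \<xi> \<eta> \<longleftrightarrow> is_term \<xi> \<and> is_term \<eta> \<and> (\<forall>\<pi>. is_stack \<pi> \<longrightarrow> star \<xi> (psh \<eta> \<pi>))"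

lemma definable_orth [dfn]: "dterm E s \<Longrightarrow> dterm E t \<Longrightarrow> definable E (\<lambda>e. orth (s e) (t e))"
  by (rule definable_subst2[where R = orth]) (unfold orth_def, intro dfn)

text \<open>\<open>K x\<close> is the result of iterating, along x and starting from the set of all terms, the operator
  that sends a set of terms U to the terms realizing \<open>\<not>\<not>U\<close> (see \<open>K_unfold\<close>).  It is introduced as
  a greatest fixed point, g being a set of pairs closed under one unfolding, so that no recursion
  theorem is needed to define it in the ground model.\<close>

definition coclosed :: "'v \<Rightarrow> bool" where
  "coclosed g \<longleftrightarrow> (\<forall>x k y p. E (pair E x k) g \<longrightarrow> below E y x \<longrightarrow> is_term p \<longrightarrow> \<not> orth k p \<longrightarrow>
     (\<exists>k'. is_term k' \<and> \<not> orth p k' \<and> E (pair E y k') g))"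

definition K :: "'v \<Rightarrow> 'v set" where
  "K x = {k. is_term k \<and> (\<exists>g. coclosed g \<and> E (pair E x k) g)}"

lemma definable_K [dfn]: "dterm E s \<Longrightarrow> dterm E t \<Longrightarrow> definable E (\<lambda>e. s e \<in> K (t e))"
  by (rule definable_subst2[where R = "\<lambda>k x. k \<in> K x"])
    (unfold K_def coclosed_def mem_Collect_eq, intro dfn)

lemma K_term: "k \<in> K x \<Longrightarrow> is_term k"
  by (simp add: K_def)

text \<open>From right to left, the graph of \<open>K\<close> on a transitive T containing x,
  enlarged by the pair of x and k, is again coclosed.\<close>

lemma K_unfold:
  "k \<in> K x \<longleftrightarrow> is_term k \<and>
     (\<forall>y p. below E y x \<longrightarrow> is_term p \<longrightarrow> (\<forall>k'\<in>K y. orth p k') \<longrightarrow> orth k p)" (is "_ \<longleftrightarrow> ?R k x")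
proof
  assume "k \<in> K x" then show "?R k x"
    unfolding K_def coclosed_def by blast
next
  assume R: "?R k x"
  obtain T where T: "transitive E T" "E x T" using ex_transitive by blast
  have "definable E (\<lambda>e. e 1 \<in> K (e 0) \<or> e 0 = x \<and> e 1 = k)" by (intro dfn)
  from relation_set[of "\<lambda>z k'. k' \<in> K z \<or> z = x \<and> k' = k", OF this, of T "Terms \<A>"] obtain g where
    g: "\<And>z k'. E (pair E z k') g \<longleftrightarrow> E z T \<and> is_term k' \<and> (k' \<in> K z \<or> z = x \<and> k' = k)"
    by auto
  have unfold: "?R k' z" if "k' \<in> K z" for k' z
    using that unfolding K_def coclosed_def by blast
  have "coclosed g"
    unfolding coclosed_def
  proof (intro allI impI)
    fix z k' y p
    assume *: "E (pair E z k') g" "below E y z" "is_term p" "\<not> orth k' p"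
    then have "?R k' z" using g R unfold by blast
    then obtain k'' where "k'' \<in> K y" "\<not> orth p k''" using * by blast
    moreover have "E y T" using below_transitive[OF T(1)] * g by blast
    ultimately show "\<exists>k''. is_term k'' \<and> \<not> orth p k'' \<and> E (pair E y k'') g"
      using g K_term by blast
  qed
  then show "k \<in> K x" using g T R unfolding K_def by blast
qed

text \<open>As there are more ordinals than sets of terms, the decreasing sequence K stabilizes.\<close>

lemma K_stable: "\<exists>x. \<forall>k p. k \<in> K x \<longrightarrow> is_term p \<longrightarrow> (\<forall>k'\<in>K x. orth p k') \<longrightarrow> orth k p"
proof -
  obtain P where P: "\<And>z. E z P \<longleftrightarrow> subset E z (Terms \<A>)" using powerset by blast
  define R where "R z a \<longleftrightarrow> (\<forall>k. E k z \<longleftrightarrow> k \<in> K a)" for z a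
  have "definable E (\<lambda>e. R (e 0) (e 1))" unfolding R_def by (intro dfn)
  moreover have "\<exists>z. E z P \<and> R z a" for a
  proof -
    have "definable E (\<lambda>e. e 0 \<in> K a)" by (intro dfn)
    from separation[of "\<lambda>k. k \<in> K a", OF this, of "Terms \<A>"] obtain z where
      "\<And>k. E k z \<longleftrightarrow> is_term k \<and> k \<in> K a" by blast
    then show ?thesis using P K_term unfolding R_def subset_def by blast
  qed
  ultimately obtain z a a' where R: "R z a" "R z a'" and a: "E a' a"
    using ordinal_collision[of R P] by blast
  \<comment> \<open>Unfolding \<open>K a\<close> at a' below a and replacing \<open>K a\<close> by
    \<open>K a'\<close> gives stability at a'.\<close>
  have "K a = K a'" using R unfolding R_def by blast
  then show ?thesis
    using K_unfold[of _ a] mem_below[OF a] by (intro exI[of _ a']) blast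
qed

section \<open>The statements psi and phi\<close>

definition psi :: "'v \<Rightarrow> 'v set" where
  "psi x = arr (K x) falsity"

definition phi :: "'v \<Rightarrow> 'v set" where
  "phi x = neg (psi x)"

lemma rz_psi: "p \<in> rz (psi x) \<longleftrightarrow> is_term p \<and> (\<forall>k\<in>K x. orth p k)"
  using K_term by (auto simp: psi_def rz_arr falsity_def orth_def)

lemma rz_phi: "q \<in> rz (phi x) \<longleftrightarrow> is_term q \<and> (\<forall>p\<in>rz (psi x). orth q p)"
  by (auto simp: phi_def neg_def rz_arr falsity_def orth_def dest: rz_term)

text \<open>Thus \<open>psi x\<close> has the same meaning as the negation of the statement that
  \<open>phi y\<close> holds for all y below x.\<close>

lemma K_eq_rz: "K x = rz (\<Union>y\<in>{y. below E y x}. phi y)"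
proof -
  have "k \<in> K x \<longleftrightarrow> is_term k \<and> (\<forall>y. below E y x \<longrightarrow> k \<in> rz (phi y))" for k
    by (auto simp: K_unfold[of k x] rz_phi rz_psi Ball_def)
  then show ?thesis by (auto simp: rz_UN)
qed

lemma definable_rz_psi [dfn]: "dterm E s \<Longrightarrow> dterm E t \<Longrightarrow> definable E (\<lambda>e. s e \<in> rz (psi (t e)))"
proof (rule definable_subst2[where R = "\<lambda>p x. p \<in> rz (psi x)"])
  have "definable E (\<lambda>e. is_term (e 0) \<and> (\<forall>k. k \<in> K (e 1) \<longrightarrow> orth (e 0) k))" by (intro dfn)
  then show "definable E (\<lambda>e. e 0 \<in> rz (psi (e 1)))" by (rule definable_cong) (auto simp: rz_psi)
qed

lemma definable_rz_phi [dfn]: "dterm E s \<Longrightarrow> dterm E t \<Longrightarrow> definable E (\<lambda>e. s e \<in> rz (phi (t e)))"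
proof (rule definable_subst2[where R = "\<lambda>p x. p \<in> rz (phi x)"])
  have "definable E (\<lambda>e. is_term (e 0) \<and> (\<forall>p. p \<in> rz (psi (e 1)) \<longrightarrow> orth (e 0) p))" by (intro dfn)
  then show "definable E (\<lambda>e. e 0 \<in> rz (phi (e 1)))" by (rule definable_cong) (auto simp: rz_phi)
qed

section \<open>Incompatibility of levels\<close>

definition level :: "bool \<Rightarrow> 'v \<Rightarrow> 'v set" where
  "level b x = (if b then phi x else psi x)"

definition sublevel :: "bool \<Rightarrow> 'v \<Rightarrow> 'v set" where
  "sublevel b x = (if b then psi x else (\<Union>y\<in>{y. below E y x}. phi y))"

lemma level_eq: "level b x = neg (sublevel b x)"
  by (simp add: level_def sublevel_def phi_def[of x] psi_def[of x] neg_def K_eq_rz[of x])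

lemma definable_rz_level [dfn]: "dterm E s \<Longrightarrow> dterm E t \<Longrightarrow> definable E (\<lambda>e. s e \<in> rz (level b (t e)))"
  by (cases b) (simp_all add: level_def definable_rz_phi definable_rz_psi)

text \<open>The realizer of \<open>clash\<close> unfolds its three arguments in turn; unfolding the
  one of the false component moves down to a smaller x, while the other ones may stay.\<close>

definition clash :: "bool \<Rightarrow> bool \<Rightarrow> bool \<Rightarrow> 'v \<Rightarrow> 'v set" where
  "clash a b c x = arr (rz (level a x)) (arr (rz (level b x)) (arr (rz (level c x)) falsity))"

definition one_false :: "(bool \<times> bool \<times> bool) set" where
  "one_false = {(False, True, True), (True, False, True), (True, True, False)}"

lemma definable_rz_clash [dfn]:
  "dterm E s \<Longrightarrow> definable E (\<lambda>e. \<theta> \<in> rz (clash a b c (s e)))"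
proof (rule definable_subst1[where R = "\<lambda>x. \<theta> \<in> rz (clash a b c x)"])
  have "definable E (\<lambda>e. is_term \<theta> \<and>
      (\<forall>p q r \<pi>. p \<in> rz (level a (e 0)) \<and> q \<in> rz (level b (e 0)) \<and> r \<in> rz (level c (e 0)) \<and>
         is_stack \<pi> \<longrightarrow> star \<theta> (psh p (psh q (psh r \<pi>)))))"
    by (intro dfn)
  then show "definable E (\<lambda>e. \<theta> \<in> rz (clash a b c (e 0)))"
    by (rule definable_cong) (simp add: clash_def rz_arr ball_arr falsity_def, meson rz_term)
qed

text \<open>With \<open>sub_hyp\<close>, both values of b take the one shape of a quantified
  negation, so that the same term unfolds either side.\<close>

definition sub_index :: "bool \<Rightarrow> 'v \<Rightarrow> 'v set" where
  "sub_index b x = (if b then {x} else {y. below E y x})"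

definition sub_hyp :: "bool \<Rightarrow> 'v \<Rightarrow> 'v set" where
  "sub_hyp b y = (if b then K y else rz (psi y))"

lemma sublevel_eq: "sublevel b x = (\<Union>y\<in>sub_index b x. arr (sub_hyp b y) falsity)"
  by (simp add: sublevel_def sub_index_def sub_hyp_def phi_def neg_def psi_def)

text \<open>Unfolding returns levels: for true b, elements of \<open>K x\<close> realize
  \<open>phi z\<close> at every z below x; for false b, the index y itself is the smaller
  point.\<close>

lemma sub_hyp_level:
  "y \<in> sub_index b x \<Longrightarrow> (b \<Longrightarrow> below E z x) \<Longrightarrow> (\<not> b \<Longrightarrow> z = y) \<Longrightarrow> sub_hyp b y \<subseteq> rz (level b z)"
  by (cases b) (auto simp: sub_index_def sub_hyp_def level_def K_eq_rz rz_UN)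

lemma clash_realized: "ent (one_false \<times> UNIV) [] (\<lambda>p. clash (fst (fst p)) (fst (snd (fst p))) (snd (snd (fst p))) (snd p))"
proof (rule ent_induct[where P = "\<lambda>i. clash (fst i) (fst (snd i)) (snd (snd i))"])
  show "definable E (\<lambda>e. \<theta> \<in> rz (clash (fst i) (fst (snd i)) (snd (snd i)) (e 0)))" for i \<theta>
    by (intro dfn)
next
  define J :: "((bool \<times> bool \<times> bool) \<times> 'v) set" where "J = one_false \<times> UNIV"
  define a b c where "a = (\<lambda>p::(bool \<times> bool \<times> bool) \<times> 'v. fst (fst p))"
    and "b = (\<lambda>p::(bool \<times> bool \<times> bool) \<times> 'v. fst (snd (fst p)))"
    and "c = (\<lambda>p::(bool \<times> bool \<times> bool) \<times> 'v. snd (snd (fst p)))"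
  define x where "x = (\<lambda>p::(bool \<times> bool \<times> bool) \<times> 'v. snd p)"
  have J: "a p \<and> b p \<and> \<not> c p \<or> a p \<and> \<not> b p \<and> c p \<or> \<not> a p \<and> b p \<and> c p" if "p \<in> J" for p
    using that by (auto simp: J_def a_def b_def c_def one_false_def)
  define R where "R = (\<lambda>p. rz (\<Union>y\<in>{y. below E y (x p)}. clash (a p) (b p) (c p) y))"
  \<comment> \<open>The point at which the false component is unfolded; it lies below x, and the
    true components can be taken there too.\<close>
  define y where "y = (\<lambda>q::((((bool \<times> bool \<times> bool) \<times> 'v) \<times> 'v) \<times> 'v) \<times> 'v.
     if \<not> a (fst (fst (fst q))) then snd (fst (fst q))
     else if \<not> b (fst (fst (fst q))) then snd (fst q) else snd q)"
  let ?p = "\<lambda>q::((((bool \<times> bool \<times> bool) \<times> 'v) \<times> 'v) \<times> 'v) \<times> 'v. fst (fst (fst q))"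
  let ?I = "SIGMA q:(SIGMA q:(SIGMA p:J. sub_index (a p) (x p)). sub_index (b (fst q)) (x (fst q))).
     sub_index (c (fst (fst q))) (x (fst (fst q)))"
  have y: "below E (y q) (x (?p q))"
      "sub_hyp (a (?p q)) (snd (fst (fst q))) \<subseteq> rz (level (a (?p q)) (y q))"
      "sub_hyp (b (?p q)) (snd (fst q)) \<subseteq> rz (level (b (?p q)) (y q))"
      "sub_hyp (c (?p q)) (snd q) \<subseteq> rz (level (c (?p q)) (y q))" if "q \<in> ?I" for q
  proof -
    have p: "?p q \<in> J" and i: "snd (fst (fst q)) \<in> sub_index (a (?p q)) (x (?p q))"
      "snd (fst q) \<in> sub_index (b (?p q)) (x (?p q))" "snd q \<in> sub_index (c (?p q)) (x (?p q))"
      using that by auto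
    show y: "below E (y q) (x (?p q))"
      using i J[OF p] by (auto simp: y_def sub_index_def)
    show "sub_hyp (a (?p q)) (snd (fst (fst q))) \<subseteq> rz (level (a (?p q)) (y q))"
      by (rule sub_hyp_level[OF i(1) y]) (use J[OF p] in \<open>auto simp: y_def\<close>)
    show "sub_hyp (b (?p q)) (snd (fst q)) \<subseteq> rz (level (b (?p q)) (y q))"
      by (rule sub_hyp_level[OF i(2) y]) (use J[OF p] in \<open>auto simp: y_def\<close>)
    show "sub_hyp (c (?p q)) (snd q) \<subseteq> rz (level (c (?p q)) (y q))"
      by (rule sub_hyp_level[OF i(3) y]) (use J[OF p] in \<open>auto simp: y_def\<close>)
  qed
  have Rq: "R (?p q) \<subseteq> rz (clash (a (?p q)) (b (?p q)) (c (?p q)) (y q))" if "q \<in> ?I" for q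
    unfolding R_def by (rule rz_antimono) (use y(1)[OF that] in auto)
  have "ent J [\<lambda>p. rz (level (c p) (x p)), \<lambda>p. rz (level (b p) (x p)), \<lambda>p. rz (level (a p) (x p)), R]
      (\<lambda>_. falsity)"
    apply (rule ent_app[where n = 2 and Q = "\<lambda>p. sublevel (a p) (x p)"])
      apply simp
     apply (simp add: level_eq neg_def)
    apply (unfold sublevel_eq, rule ent_UN, rule ent_impI, unfold list.map)
    apply (rule ent_app[where n = 2 and Q = "\<lambda>p. sublevel (b (fst p)) (x (fst p))"])
      apply simp
     apply (simp add: level_eq neg_def)
    apply (unfold sublevel_eq, rule ent_UN, rule ent_impI, unfold list.map)
    apply (rule ent_app[where n = 2 and Q = "\<lambda>p. sublevel (c (fst (fst p))) (x (fst (fst p)))"])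
      apply simp
     apply (simp add: level_eq neg_def)
    apply (unfold sublevel_eq, rule ent_UN, rule ent_impI, unfold list.map)
    apply (rule ent_app_assm[where n = 0 and Q = "\<lambda>q. level (c (?p q)) (y q)"])
      apply (rule ent_app_assm[where n = 1 and Q = "\<lambda>q. level (b (?p q)) (y q)"])
        apply (rule ent_app_assm[where n = 2 and Q = "\<lambda>q. level (a (?p q)) (y q)"])
          apply (rule ent_assm[where n = 6])
           apply simp
          apply (drule Rq, simp add: clash_def)
         apply simp
        apply (drule y(2), simp)
       apply simp
      apply (drule y(3), simp)
     apply simp
    apply (drule y(4), simp)
    done
  then show "ent (one_false \<times> UNIV) [] (\<lambda>p. arr (rz (\<Union>y\<in>{y. below E y (snd p)}.
      clash (fst (fst p)) (fst (snd (fst p))) (snd (snd (fst p))) y))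
      (clash (fst (fst p)) (fst (snd (fst p))) (snd (snd (fst p))) (snd p)))"
    using ent_impI unfolding J_def R_def a_def b_def c_def x_def
    unfolding clash_def by (intro ent_impI)
qed

section \<open>Boolean operations under \<open>\<D>\<close>\<close>

lemma arrI: "\<xi> \<in> T \<Longrightarrow> is_term \<xi> \<Longrightarrow> \<pi> \<in> P \<Longrightarrow> is_stack \<pi> \<Longrightarrow> psh \<xi> \<pi> \<in> arr T P"
  by (auto simp: arr_def)

lemma ent_cut: "ent I [\<lambda>i. rz (Q i)] P \<Longrightarrow> ent I G Q \<Longrightarrow> ent I G P"
  by (rule ent_mp[OF ent_lift[OF ent_impI]])

lemma ent_subset: "ent I G P \<Longrightarrow> J \<subseteq> I \<Longrightarrow> ent J G P"
  by (auto simp: ent_def)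

text \<open>\<open>C I\<close> exchanges the induction hypothesis \<xi> with the top \<eta> of the
  stack and runs \<eta> on \<xi>, which realizes progressivity of X. The outer \<open>C I\<close>
  hands this term to the realizer of \<D>[b].\<close>

lemma swap_realizer:
  assumes X: "\<And>x \<xi> \<pi>. \<xi> \<in> rz (\<Union>y\<in>{y. guard b y x}. nE y X) \<Longrightarrow> \<pi> \<in> nE x X \<Longrightarrow>
      \<exists>\<eta> \<rho>. \<pi> = psh \<eta> \<rho> \<and> is_stack \<rho> \<and> orth \<eta> \<xi>"
    and P: "\<And>\<pi>. \<pi> \<in> P \<Longrightarrow> is_stack \<pi> \<Longrightarrow> \<exists>x. \<pi> \<in> nE x X"
  shows "ap \<A> (ap \<A> (cC \<A>) (cI \<A>)) (ap \<A> (cC \<A>) (cI \<A>)) \<in> rz (arr (rz (DV b)) P)"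
proof -
  have "ap \<A> (cC \<A>) (cI \<A>) \<in> rz (prog b X)"
    unfolding prog_def rz_UN
  proof (intro conjI ballI)
    fix x
    have "star (ap \<A> (cC \<A>) (cI \<A>)) (psh \<xi> \<pi>)"
      if "\<xi> \<in> rz (\<Union>y\<in>{y. guard b y x}. nE y X)" "\<pi> \<in> nE x X" for \<xi> \<pi>
      using X[OF that] rz_term[OF that(1)]
      by (auto simp: orth_def intro!: star_ap star_C star_I)
    then show "ap \<A> (cC \<A>) (cI \<A>) \<in> rz (arr (rz (\<Union>y\<in>{y. guard b y x}. nE y X)) (nE x X))"
      by (simp add: rz_arr)
  qed simp
  then have "psh (ap \<A> (cC \<A>) (cI \<A>)) \<pi> \<in> DV b" if "\<pi> \<in> P" "is_stack \<pi>" for \<pi>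
    unfolding DV_def using P[OF that] that(2) by (auto intro!: exI[of _ X] arrI)
  then have "star v (psh (ap \<A> (cC \<A>) (cI \<A>)) \<pi>)" if "v \<in> rz (DV b)" "\<pi> \<in> P" "is_stack \<pi>" for v \<pi>
    using that by (intro rzD[OF that(1)]) auto
  then show ?thesis
    by (auto simp: rz_arr intro!: star_ap star_C star_I)
qed

lemma definable_psi [dfn]: "dterm E s \<Longrightarrow> dterm E t \<Longrightarrow> definable E (\<lambda>e. s e \<in> psi (t e))"
proof (rule definable_subst2[where R = "\<lambda>\<pi> x. \<pi> \<in> psi x"])
  have "definable E (\<lambda>e. \<exists>k \<rho>. k \<in> K (e 1) \<and> is_stack \<rho> \<and> e 0 = psh k \<rho>)" by (intro dfn)
  then show "definable E (\<lambda>e. e 0 \<in> psi (e 1))"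
    by (rule definable_cong) (use K_term in \<open>auto simp: psi_def arr_def falsity_def\<close>)
qed

lemma definable_phi [dfn]: "dterm E s \<Longrightarrow> dterm E t \<Longrightarrow> definable E (\<lambda>e. s e \<in> phi (t e))"
proof (rule definable_subst2[where R = "\<lambda>\<pi> x. \<pi> \<in> phi x"])
  have "definable E (\<lambda>e. \<exists>k \<rho>. k \<in> rz (psi (e 1)) \<and> is_stack \<rho> \<and> e 0 = psh k \<rho>)" by (intro dfn)
  then show "definable E (\<lambda>e. e 0 \<in> phi (e 1))"
    by (rule definable_cong) (use rz_term in \<open>auto simp: phi_def neg_def arr_def falsity_def\<close>)
qed

text \<open>For true b, X is given by \<open>phi\<close>, and the induction hypothesis lies in
  \<open>K y\<close>, to which realizers of \<open>psi y\<close> are orthogonal. For false b, X is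
  \<open>psi x\<close> at a single point, and the vacuous guard makes the induction hypothesis a
  realizer of \<open>psi x\<close>.\<close>

lemma DV_level:
  assumes x: "\<And>k p. k \<in> K x \<Longrightarrow> is_term p \<Longrightarrow> (\<forall>k'\<in>K x. orth p k') \<Longrightarrow> orth k p"
  shows "ap \<A> (ap \<A> (cC \<A>) (cI \<A>)) (ap \<A> (cC \<A>) (cI \<A>)) \<in> rz (arr (rz (DV b)) (level b x))"
proof (cases b)
  case True
  obtain T where T: "transitive E T" "E x T" using ex_transitive by blast
  have "definable E (\<lambda>e. e 1 \<in> phi (e 0))" by (intro dfn)
  from ex_nE[of "\<lambda>x \<pi>. \<pi> \<in> phi x", OF this, of T] obtain X where
    X: "\<And>x. nE x X = (if E x T then {\<pi>. is_stack \<pi> \<and> \<pi> \<in> phi x} else {})" by blast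
  show ?thesis
  proof (rule swap_realizer[where b = b and X = X])
    fix y \<xi> \<pi> assume \<xi>: "\<xi> \<in> rz (\<Union>z\<in>{z. guard b z y}. nE z X)" and \<pi>: "\<pi> \<in> nE y X"
    have y: "E y T" "\<pi> \<in> phi y" using \<pi> X by (auto split: if_splits)
    have "(\<Union>z\<in>{z. below E z y}. phi z) \<inter> falsity \<subseteq> (\<Union>z\<in>{z. guard b z y}. nE z X)"
      using X below_transitive[OF T(1) y(1)] True by (auto simp: guard_def falsity_def)
    then have "\<xi> \<in> K y" using \<xi> rz_antimono K_eq_rz[of y] by blast
    then show "\<exists>\<eta> \<rho>. \<pi> = psh \<eta> \<rho> \<and> is_stack \<rho> \<and> orth \<eta> \<xi>"
      using y(2) by (auto simp: phi_def neg_def arr_def rz_psi)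
  qed (use T X True in \<open>auto simp: level_def\<close>)
next
  case False
  have "definable E (\<lambda>e. e 1 \<in> psi x)" by (intro dfn)
  from ex_nE[of "\<lambda>_ \<pi>. \<pi> \<in> psi x", OF this, of "one E"] obtain X where
    X: "\<And>y. nE y X = (if E y (one E) then {\<pi>. is_stack \<pi> \<and> \<pi> \<in> psi x} else {})" by blast
  have one: "E (empty E) (one E)" by (simp add: one_def)
  show ?thesis
  proof (rule swap_realizer[where b = b and X = X])
    fix y \<xi> \<pi> assume \<xi>: "\<xi> \<in> rz (\<Union>z\<in>{z. guard b z y}. nE z X)" and \<pi>: "\<pi> \<in> nE y X"
    have "psi x \<inter> falsity \<subseteq> (\<Union>z\<in>{z. guard b z y}. nE z X)"
      using X[of "empty E"] one False by (auto simp: guard_def falsity_def)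
    then have "\<xi> \<in> rz (psi x)" using \<xi> rz_antimono by blast
    \<comment> \<open>Here stability at x enters: elements of \<open>K x\<close> are orthogonal to
      realizers of \<open>psi x\<close>.\<close>
    then have "orth k \<xi>" if "k \<in> K x" for k using x[OF that] by (simp add: rz_psi)
    moreover have "\<pi> \<in> psi x" using \<pi> X by (auto split: if_splits)
    ultimately show "\<exists>\<eta> \<rho>. \<pi> = psh \<eta> \<rho> \<and> is_stack \<rho> \<and> orth \<eta> \<xi>"
      by (auto simp: psi_def arr_def)
  qed (use one X False in \<open>auto simp: level_def\<close>)
qed

lemma DV_contradiction:
  assumes abc: "\<And>i. i \<in> I \<Longrightarrow> \<not> (a i \<and> b i \<and> c i)"
    and a: "ent I G (\<lambda>i. DV (a i))" and b: "ent I G (\<lambda>i. DV (b i))" and c: "ent I G (\<lambda>i. DV (c i))"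
  shows "ent I G (\<lambda>_. falsity)"
proof -
  obtain x where "\<forall>k p. k \<in> K x \<longrightarrow> is_term p \<longrightarrow> (\<forall>k'\<in>K x. orth p k') \<longrightarrow> orth k p"
    using K_stable ..
  then have x: "\<And>k p. k \<in> K x \<Longrightarrow> is_term p \<Longrightarrow> (\<forall>k'\<in>K x. orth p k') \<Longrightarrow> orth k p"
    by simp
  have level: "ent I G (\<lambda>i. level (d' i) x)"
    if d: "ent I G (\<lambda>i. DV (d i))" and le: "\<And>i. d i \<longrightarrow> d' i" for d d'
  proof (rule ent_mp)
    show "ent I G (\<lambda>i. DV (d' i))"
      by (rule ent_sub[OF d]) (intro le_infI1 DV_antimono le)
    show "ent I G (\<lambda>i. arr (rz (DV (d' i))) (level (d' i) x))"
      by (rule ent_lift, rule ent_closed[OF _ DV_level[OF x]]) simp_all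
  qed
  \<comment> \<open>\<open>clash_realized\<close> covers exactly one false component, so surplus
    zeros are raised to one, as monotonicity of \<D> permits.\<close>
  define b' where "b' i \<longleftrightarrow> b i \<or> \<not> a i" for i
  define c' where "c' i \<longleftrightarrow> c i \<or> \<not> a i \<or> \<not> b i" for i
  have "ent I [] (\<lambda>i. clash (a i) (b' i) (c' i) x)"
  proof (rule ent_reindex[OF clash_realized])
    fix i \<pi> assume "i \<in> I" "\<pi> \<in> clash (a i) (b' i) (c' i) x"
    moreover have "(a i, b' i, c' i) \<in> one_false"
      using abc[OF \<open>i \<in> I\<close>] by (auto simp: one_false_def b'_def c'_def)
    ultimately show "\<exists>p\<in>one_false \<times> UNIV.
        \<pi> \<in> clash (fst (fst p)) (fst (snd (fst p))) (snd (snd (fst p))) (snd p) \<and>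
        list_all2 (\<lambda>T S. T i \<subseteq> S p) [] []"
      by (intro bexI[of _ "((a i, b' i, c' i), x)"]) auto
  qed
  then have clash: "ent I G (\<lambda>i. clash (a i) (b' i) (c' i) x)" by (rule ent_lift)
  have la: "ent I G (\<lambda>i. level (a i) x)" by (rule level[OF a]) simp
  have lb: "ent I G (\<lambda>i. level (b' i) x)" by (rule level[OF b]) (simp add: b'_def)
  have lc: "ent I G (\<lambda>i. level (c' i) x)" by (rule level[OF c]) (simp add: c'_def)
  show ?thesis
    by (rule ent_mp[OF ent_mp[OF ent_mp[OF clash[unfolded clash_def] la] lb] lc])
qed

text \<open>Otherwise \<D>[\<not>b] by excluded middle, but a, a \<longrightarrow> b and \<not>b are
  never all true.\<close>

lemma DV_mp: "ent I [\<lambda>i. rz (DV (a i)), \<lambda>i. rz (DV (a i \<longrightarrow> b i))] (\<lambda>i. DV (b i))"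
proof (rule ent_contradiction, rule DV_contradiction)
  let ?G = "[\<lambda>i. rz (neg (DV (b i))), \<lambda>i. rz (DV (a i)), \<lambda>i. rz (DV (a i \<longrightarrow> b i))]"
  show "ent I ?G (\<lambda>i. DV (\<not> b i))"
    by (rule ent_cut[OF excluded_middle]) (rule ent_assm[of 0], simp_all)
  show "ent I ?G (\<lambda>i. DV (a i))" by (rule ent_assm[of 1]) simp_all
  show "ent I ?G (\<lambda>i. DV (a i \<longrightarrow> b i))" by (rule ent_assm[of 2]) simp_all
qed blast

text \<open>Otherwise excluded middle gives \<D>[\<not>(a \<longrightarrow> b)], hence \<D>[a] by
  monotonicity and \<D>[b] by hypothesis, which is contradictory.\<close>

lemma DV_imp: "ent I [\<lambda>i. rz (arr (rz (DV (a i))) (DV (b i)))] (\<lambda>i. DV (a i \<longrightarrow> b i))"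
proof (rule ent_contradiction)
  let ?G = "[\<lambda>i. rz (neg (DV (a i \<longrightarrow> b i))), \<lambda>i. rz (arr (rz (DV (a i))) (DV (b i)))]"
  have n: "ent I ?G (\<lambda>i. DV (\<not> (a i \<longrightarrow> b i)))"
    by (rule ent_cut[OF excluded_middle]) (rule ent_assm[of 0], simp_all)
  have "ent I ?G (\<lambda>i. DV (a i))"
    by (rule ent_sub[OF n]) (intro le_infI1 DV_antimono, blast)
  then have b: "ent I ?G (\<lambda>i. DV (b i))"
    by (rule ent_app[of 1, rotated 2]) simp_all
  show "ent I ?G (\<lambda>_. falsity)"
    by (rule DV_contradiction[OF _ n n b]) blast
qed

text \<open>Excluded middle at 0, where \<D>[0] is refuted.\<close>

lemma DV_True: "ent I [] (\<lambda>_. DV True)"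
proof -
  have "ent I [\<lambda>_. rz (neg (DV False))] (\<lambda>_. DV True)"
    using excluded_middle[of I "\<lambda>_. False"] by simp
  moreover have "ent I [] (\<lambda>_. neg (DV False))"
    by (rule ent_closed[OF _ DV_False_realizer]) simp
  ultimately show ?thesis by (rule ent_cut)
qed

section \<open>Truth in \<open>\<M>\<^sub>\<D>\<close>\<close>

lemma realizing_terms_eq: "P \<subseteq> falsity \<Longrightarrow> realizing_terms E \<A> P = rz P"
  by (auto simp: realizing_terms_def rz_def star_def falsity_def)

text \<open>\<open>push\<close> and its total version \<open>psh\<close> agree on terms and
  stacks.\<close>

lemma truth_value_EImpl:
  assumes "truth_value E \<A> F e \<subseteq> falsity" "truth_value E \<A> G e \<subseteq> falsity"
  shows "truth_value E \<A> (EImpl F G) e = arr (rz (truth_value E \<A> F e)) (truth_value E \<A> G e)"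
proof -
  let ?T = "rz (truth_value E \<A> F e)" and ?P = "truth_value E \<A> G e"
  have "(\<exists>\<xi> \<pi>. x = push \<A> \<xi> \<pi> \<and> \<xi> \<in> ?T \<and> \<pi> \<in> ?P) \<longleftrightarrow>
      (\<exists>\<xi> \<pi>. x = psh \<xi> \<pi> \<and> \<xi> \<in> ?T \<and> is_term \<xi> \<and> \<pi> \<in> ?P \<and> is_stack \<pi>)" for x
    by (intro ex_cong1) (use assms in \<open>auto simp: psh_def falsity_def dest: rz_term\<close>)
  then show ?thesis
    by (simp add: realizing_terms_eq[OF assms(1)] arr_def)
qed

lemma truth_value_DD:
  assumes "f [e i, e j] = (if b then one E else empty E)"
  shows "truth_value E \<A> (DD E (Fn f [Var i, Var j])) e = DV b"
proof -
  have eps: "truth_value E \<A> (NotEps (Var k) (Var l)) e = nE (e k) (e l)" for k l and e :: "nat \<Rightarrow> 'v"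
    by (simp add: nE_def)
  \<comment> \<open>As \<open>one E\<close> and \<open>empty E\<close> differ, the order of {0,1}
    becomes implication.\<close>
  have ge: "bool_ge E [below_fn E [y, x], f [e i, e j]] \<longleftrightarrow> guard b y x" for x y
    by (simp add: bool_ge_def below_fn_def char_fn_def assms guard_def)
  have nE: "nE x X \<subseteq> falsity" for x X
    by (auto simp: nE_def falsity_def)
  let ?G = "EForall (Guard (bool_ge E) [Fn (below_fn E) [Var 0, Var 1], lift 3 (Fn f [Var i, Var j])]
      (NotEps (Var 0) (Var 2)))"
  have G: "truth_value E \<A> ?G (case_nat x (case_nat X e)) = (\<Union>y\<in>{y. guard b y x}. nE y X)" for x X
    by (auto simp: eps ge numeral_3_eq_3 numeral_2_eq_2 simp del: truth_value.simps(1))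
  have H: "truth_value E \<A> (EForall (EImpl ?G (NotEps (Var 0) (Var 1)))) (case_nat X e) = prog b X" for X
  proof -
    have "truth_value E \<A> (EImpl ?G (NotEps (Var 0) (Var 1))) (case_nat x (case_nat X e)) =
        arr (rz (\<Union>y\<in>{y. guard b y x}. nE y X)) (nE x X)" for x
      by (subst truth_value_EImpl) (use nE in \<open>auto simp only: G eps, auto\<close>)
    then show ?thesis by (simp only: truth_value.simps(6) prog_def)
  qed
  have N: "truth_value E \<A> (EForall (NotEps (Var 0) (Var 1))) (case_nat X e) = (\<Union>x. nE x X)" for X
    by (auto simp: nE_def)
  have "prog b X \<subseteq> falsity" for X
    unfolding prog_def by (intro UN_least arr_subset_falsity)
  moreover have "(\<Union>x. nE x X) \<subseteq> falsity" for X using nE by blast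
  ultimately have "truth_value E \<A> (EImpl (EForall (EImpl ?G (NotEps (Var 0) (Var 1))))
      (EForall (NotEps (Var 0) (Var 1)))) (case_nat X e) = arr (rz (prog b X)) (\<Union>x. nE x X)" for X
    by (subst truth_value_EImpl) (simp_all only: H N)
  then show ?thesis
    unfolding DD_def DV_def truth_value.simps(6)[of E \<A> "EImpl _ _"] by simp
qed

lemma truth_value_MD_atomic:
  "truth_value E \<A> (MD E (Mem i j)) e = DV (sat E (Mem i j) e)"
  "truth_value E \<A> (MD E (Eq i j)) e = DV (sat E (Eq i j) e)"
  unfolding MD.simps by (rule truth_value_DD, simp add: formula_fn_def char_fn_def)+

lemma DV_subset_falsity: "DV b \<subseteq> falsity"
  unfolding DV_def by (intro UN_least arr_subset_falsity)

lemma truth_value_MD_subset: "truth_value E \<A> (MD E F) e \<subseteq> falsity"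
proof (induction F arbitrary: e)
  case (Impl F G)
  then show ?case
    unfolding MD.simps by (subst truth_value_EImpl) (auto intro!: arr_subset_falsity)
next
  case (Forall F)
  then show ?case by auto
next
  case Fls
  then show ?case by (simp add: falsity_def)
qed (simp_all only: truth_value_MD_atomic DV_subset_falsity)

text \<open>Indexing by all valuations makes the realizers depend on F only. For atoms both sides
  have the same truth value; implication rests on \<open>DV_mp\<close> and
  \<open>DV_imp\<close>.\<close>

lemma MD_iff_DV:
  "ent UNIV [\<lambda>e. rz (DV (sat E F e))] (truth_value E \<A> (MD E F)) \<and>
   ent UNIV [\<lambda>e. rz (truth_value E \<A> (MD E F) e)] (\<lambda>e. DV (sat E F e))"
proof (induction F)
  case (Mem i j)
  show ?case unfolding truth_value_MD_atomic[abs_def] by (intro conjI; rule ent_assm[of 0]; simp)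
next
  case (Eq i j)
  show ?case unfolding truth_value_MD_atomic[abs_def] by (intro conjI; rule ent_assm[of 0]; simp)
next
  case Fls
  have "ent UNIV [] (\<lambda>_. neg (DV False))"
    by (rule ent_closed[OF _ DV_False_realizer]) simp
  then have "ent UNIV [\<lambda>_. rz (DV False)] (\<lambda>_. falsity)"
    unfolding neg_def by (rule ent_impE)
  moreover have "ent UNIV [\<lambda>_. rz falsity] (\<lambda>_. DV False)"
    by (rule ent_assm[of 0]) (simp_all add: rz_antimono DV_subset_falsity le_infI1)
  ultimately show ?case by (simp add: falsity_def)
next
  case (Impl F G)
  let ?F = "truth_value E \<A> (MD E F)" and ?G = "truth_value E \<A> (MD E G)"
  have FG: "truth_value E \<A> (MD E (Impl F G)) = (\<lambda>e. arr (rz (?F e)) (?G e))"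
    by (rule ext) (simp add: truth_value_EImpl truth_value_MD_subset del: truth_value.simps)
  have "ent UNIV [\<lambda>e. rz (?F e), \<lambda>e. rz (DV (sat E F e \<longrightarrow> sat E G e))] ?G"
  proof (rule ent_cut[OF Impl.IH(2)[THEN conjunct1]], rule ent_mp)
    show "ent UNIV [\<lambda>e. rz (?F e), \<lambda>e. rz (DV (sat E F e \<longrightarrow> sat E G e))] (\<lambda>e. DV (sat E F e))"
      by (rule ent_cut[OF Impl.IH(1)[THEN conjunct2]]) (rule ent_assm[of 0], simp_all)
    show "ent UNIV [\<lambda>e. rz (?F e), \<lambda>e. rz (DV (sat E F e \<longrightarrow> sat E G e))]
        (\<lambda>e. arr (rz (DV (sat E F e))) (DV (sat E G e)))"
      by (rule ent_weak, rule ent_impI, rule DV_mp)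
  qed
  then have 1: "ent UNIV [\<lambda>e. rz (DV (sat E F e \<longrightarrow> sat E G e))] (\<lambda>e. arr (rz (?F e)) (?G e))"
    by (rule ent_impI)
  have "ent UNIV [\<lambda>e. rz (DV (sat E F e)), \<lambda>e. rz (arr (rz (?F e)) (?G e))] (\<lambda>e. DV (sat E G e))"
  proof (rule ent_cut[OF Impl.IH(2)[THEN conjunct2]], rule ent_app[of 1])
    show "ent UNIV [\<lambda>e. rz (DV (sat E F e)), \<lambda>e. rz (arr (rz (?F e)) (?G e))] ?F"
      by (rule ent_cut[OF Impl.IH(1)[THEN conjunct1]]) (rule ent_assm[of 0], simp_all)
  qed simp_all
  then have 2: "ent UNIV [\<lambda>e. rz (arr (rz (?F e)) (?G e))] (\<lambda>e. DV (sat E F e \<longrightarrow> sat E G e))"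
    by (rule ent_cut[OF DV_imp ent_impI])
  show ?case using 1 2 by (simp add: FG del: MD.simps truth_value.simps)
next
  case (Forall F)
  let ?F = "truth_value E \<A> (MD E F)"
  have "ent UNIV [\<lambda>e. rz (DV (\<forall>a. sat E F (case_nat a e)))] (\<lambda>e. \<Union>a. ?F (case_nat a e))"
  proof (rule ent_reindex[OF Forall[THEN conjunct1]])
    fix e \<pi> assume "\<pi> \<in> (\<Union>a. ?F (case_nat a e))"
    then obtain a where a: "\<pi> \<in> ?F (case_nat a e)" by blast
    have "DV (sat E F (case_nat a e)) \<subseteq> DV (\<forall>a. sat E F (case_nat a e))"
      by (rule DV_antimono) blast
    then have "rz (DV (\<forall>a. sat E F (case_nat a e))) \<subseteq> rz (DV (sat E F (case_nat a e)))"
      by (intro rz_antimono) blast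
    with a show "\<exists>j\<in>UNIV. \<pi> \<in> ?F j \<and> list_all2 (\<lambda>T S. T e \<subseteq> S j)
        [\<lambda>e. rz (DV (\<forall>a. sat E F (case_nat a e)))] [\<lambda>e. rz (DV (sat E F e))]"
      by (intro bexI[of _ "case_nat a e"]) simp_all
  qed
  moreover have "ent UNIV [\<lambda>e. rz (\<Union>a. ?F (case_nat a e))] (\<lambda>e. DV (\<forall>a. sat E F (case_nat a e)))"
  proof (rule ent_reindex[OF Forall[THEN conjunct2]])
    fix e \<pi> assume \<pi>: "\<pi> \<in> DV (\<forall>a. sat E F (case_nat a e))"
    \<comment> \<open>Satisfaction is two-valued: a is a counterexample if there is one, and
      arbitrary otherwise.\<close>
    obtain a where a: "(\<forall>a. sat E F (case_nat a e)) \<longleftrightarrow> sat E F (case_nat a e)" by blast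
    have "rz (\<Union>a. ?F (case_nat a e)) \<subseteq> rz (?F (case_nat a e))"
      by (rule rz_antimono) blast
    with a \<pi> show "\<exists>j\<in>UNIV. \<pi> \<in> DV (sat E F j) \<and> list_all2 (\<lambda>T S. T e \<subseteq> S j)
        [\<lambda>e. rz (\<Union>a. ?F (case_nat a e))] [\<lambda>e. rz (?F e)]"
      by (intro bexI[of _ "case_nat a e"]) simp_all
  qed
  ultimately show ?case by simp
qed

lemma realized_if_ent: "ent {e} [] (truth_value E \<A> F) \<Longrightarrow> truth_value E \<A> F e \<subseteq> falsity \<Longrightarrow> realized E \<A> F e"
  by (auto simp: realized_def ent_def realizing_terms_eq)

lemma realized_MD:
  assumes "sat E F e"
  shows "realized E \<A> (MD E F) e"
proof (rule realized_if_ent[OF _ truth_value_MD_subset])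
  have "ent {e} [\<lambda>e. rz (DV (sat E F e))] (truth_value E \<A> (MD E F))"
    using MD_iff_DV ent_subset by blast
  moreover have "ent {e} [] (\<lambda>e. DV (sat E F e))"
    by (rule ent_sub[OF DV_True]) (simp add: assms)
  ultimately show "ent {e} [] (truth_value E \<A> (MD E F))" by (rule ent_cut)
qed

end

theorem theorem27:
  fixes E :: "'v \<Rightarrow> 'v \<Rightarrow> bool" and \<A> :: "'v ralg"
    and F :: fm and a :: "nat \<Rightarrow> 'v"
  assumes "zf_model E" and "V_equals_L E" and "realizability_algebra E \<A>"
  shows "(sat E F a \<longrightarrow> realized E \<A> (MD E F) a) \<and>
         (\<not> sat E F a \<longrightarrow> realized E \<A> (MD E (Neg F)) a)"
proof -
  interpret realizability_model E \<A>
    by unfold_locales (use assms in auto)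
  show ?thesis using realized_MD[of F a] realized_MD[of "Neg F" a] by (simp add: Neg_def)
qed

end
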